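(* Let $\Omega$, $B$, $\phi$, $\epsilon>0$, $D$ and $d$ be as in the context. Consider the two bilinear forms on $H^1_0(B)$ $$a_0(u,v) := \int_B D\,\nabla u\cdot\nabla(\phi v)+\frac{D}{\epsilon^{2}}(1-\phi)\,uv+\frac{3D}{2\epsilon}\left[(1-\phi)+(1-\phi)^2\right]|\nabla\phi|\,uv\;dx,$$ $$a_1(u,v) := \int_B D\,\nabla u\cdot\nabla(\phi v)+\frac{D}{\epsilon^{2}}(1-\phi)\,uv+D\,u\,\nabla\phi\cdot\nabla v+\frac{3D}{2\epsilon}\left[4(1-\phi)+(1-\phi)^2\right]|\nabla\phi|\,uv\;dx .$$ Then both $a_0$ and $a_1$ are coercive: for each $i\in\{0,1\}$ there is a constant $C>0$ such that $a_i(u,u)\ge C\|u\|^2$ for all $u\in H^1_0(B)$, with respect to the norm $$\|u\|^2 := \int_B \phi|\nabla u|^2+\epsilon^{-3}(1-\phi)|u|^2\;dx .$$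
   Context: $\Omega\subset\mathbb{R}^n$ is a sufficiently smooth bounded domain, and $B\supset\Omega$ is a larger bounded domain. $r$ is the signed distance function of $\Omega$ (negative in $\Omega$, positive outside, $|\nabla r|=1$ almost everywhere). For a fixed parameter $\epsilon>0$ the phase-field function is $$\phi(x)=\tfrac12\left(1-\tanh\left(\tfrac{3r(x)}{\epsilon}\right)\right),\quad x\in B,$$ so $\phi$ takes values in $(0,1)$ and $\nabla\phi=-\frac{6}{\epsilon}\phi(1-\phi)\nabla r$. $D:B\to\mathbb{R}$ is a bounded scalar function with $D(x)\ge d>0$ for a constant $d$. The parameter $\epsilon$ is fixed, and the coercivity constant is only required to be independent of $u$. *)

theory Defs
  imports "HOL-Analysis.Analysis"
begin

section \<open>Domains and the signed distance function\<close>

definition bounded_domain :: "'a::euclidean_space set \<Rightarrow> bool" where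
  "bounded_domain S \<longleftrightarrow> open S \<and> connected S \<and> bounded S \<and> S \<noteq> {}"

text \<open>
  Boundary of class \<open>C\<^sup>1\<close>, by local defining functions with nonvanishing gradient; every domain
  with a smoother boundary satisfies this as well.
\<close>

definition C1_boundary :: "'a::euclidean_space set \<Rightarrow> bool" where
  "C1_boundary S \<longleftrightarrow>
     (\<forall>p\<in>frontier S. \<exists>U \<rho> G. open U \<and> p \<in> U \<and>
        (\<forall>x\<in>U. GDERIV \<rho> x :> G x \<and> G x \<noteq> 0) \<and> continuous_on U G \<and>
        S \<inter> U = {x\<in>U. \<rho> x < 0})"

definition signed_distance :: "'a::euclidean_space set \<Rightarrow> 'a \<Rightarrow> real" where
  "signed_distance S x =
     (if x \<in> S then - infdist x (frontier S) else infdist x (frontier S))"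


section \<open>Sobolev spaces\<close>

text \<open>
  Functions on an open set \<open>S\<close> are represented by functions on the whole space whose values
  outside \<open>S\<close> are irrelevant; elements of the Sobolev spaces are represented by
  Lebesgue measurable functions rather than by classes modulo null sets.
\<close>

primrec Ck :: "nat \<Rightarrow> ('a::euclidean_space \<Rightarrow> real) \<Rightarrow> bool" where
  "Ck 0 f \<longleftrightarrow> continuous_on UNIV f"
| "Ck (Suc k) f \<longleftrightarrow> (\<forall>x. f differentiable (at x)) \<and>
     (\<forall>b\<in>Basis. Ck k (\<lambda>x. frechet_derivative f (at x) b))"

definition test_functions :: "'a::euclidean_space set \<Rightarrow> ('a \<Rightarrow> real) set" where
  "test_functions S =
     {\<psi>. (\<forall>k. Ck k \<psi>) \<and> compact (closure {x. \<psi> x \<noteq> 0}) \<and> closure {x. \<psi> x \<noteq> 0} \<subseteq> S}"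

definition has_weak_gradient ::
    "'a::euclidean_space set \<Rightarrow> ('a \<Rightarrow> real) \<Rightarrow> ('a \<Rightarrow> 'a) \<Rightarrow> bool" where
  "has_weak_gradient S f g \<longleftrightarrow>
     (\<forall>K. compact K \<and> K \<subseteq> S \<longrightarrow> f absolutely_integrable_on K \<and> g absolutely_integrable_on K) \<and>
     (\<forall>\<psi>\<in>test_functions S. \<forall>b\<in>Basis.
        (LINT x|lebesgue_on S. f x * frechet_derivative \<psi> (at x) b) =
        - (LINT x|lebesgue_on S. (g x \<bullet> b) * \<psi> x))"

text \<open>
  Weak gradients are unique only up to null sets, so \<open>wgrad\<close> picks a representative; it is
  meaningful only for weakly differentiable \<open>f\<close>.
\<close>

definition wgrad :: "'a::euclidean_space set \<Rightarrow> ('a \<Rightarrow> real) \<Rightarrow> 'a \<Rightarrow> 'a" where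
  "wgrad S f = (SOME g. has_weak_gradient S f g)"

definition H1 :: "'a::euclidean_space set \<Rightarrow> ('a \<Rightarrow> real) set" where
  "H1 S = {u. u \<in> borel_measurable (lebesgue_on S) \<and>
              integrable (lebesgue_on S) (\<lambda>x. (u x)\<^sup>2) \<and>
              (\<exists>g. has_weak_gradient S u g \<and> integrable (lebesgue_on S) (\<lambda>x. (norm (g x))\<^sup>2))}"

definition H1_norm :: "'a::euclidean_space set \<Rightarrow> ('a \<Rightarrow> real) \<Rightarrow> real" where
  "H1_norm S u = sqrt (LINT x|lebesgue_on S. (u x)\<^sup>2 + (norm (wgrad S u x))\<^sup>2)"

text \<open>The closure of the test functions in \<open>H\<^sup>1\<close>.\<close>

definition H1_0 :: "'a::euclidean_space set \<Rightarrow> ('a \<Rightarrow> real) set" where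
  "H1_0 S = {u\<in>H1 S. \<exists>\<psi>. (\<forall>k::nat. \<psi> k \<in> test_functions S) \<and>
                 (\<lambda>k. H1_norm S (\<lambda>x. u x - \<psi> k x)) \<longlonglongrightarrow> 0}"


section \<open>Bilinear forms and the weighted norm\<close>

definition form_a0 ::
    "'a::euclidean_space set \<Rightarrow> real \<Rightarrow> ('a \<Rightarrow> real) \<Rightarrow> ('a \<Rightarrow> real) \<Rightarrow> ('a \<Rightarrow> real) \<Rightarrow> ('a \<Rightarrow> real) \<Rightarrow> real"
  where
  "form_a0 B \<epsilon> D \<phi> u v =
     (LINT x|lebesgue_on B.
        D x * (wgrad B u x \<bullet> wgrad B (\<lambda>y. \<phi> y * v y) x)
        + D x / \<epsilon>\<^sup>2 * (1 - \<phi> x) * u x * v x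
        + 3 * D x / (2 * \<epsilon>) * ((1 - \<phi> x) + (1 - \<phi> x)\<^sup>2) * norm (wgrad B \<phi> x) * u x * v x)"

definition form_a1 ::
    "'a::euclidean_space set \<Rightarrow> real \<Rightarrow> ('a \<Rightarrow> real) \<Rightarrow> ('a \<Rightarrow> real) \<Rightarrow> ('a \<Rightarrow> real) \<Rightarrow> ('a \<Rightarrow> real) \<Rightarrow> real"
  where
  "form_a1 B \<epsilon> D \<phi> u v =
     (LINT x|lebesgue_on B.
        D x * (wgrad B u x \<bullet> wgrad B (\<lambda>y. \<phi> y * v y) x)
        + D x / \<epsilon>\<^sup>2 * (1 - \<phi> x) * u x * v x
        + D x * u x * (wgrad B \<phi> x \<bullet> wgrad B v x)
        + 3 * D x / (2 * \<epsilon>) * (4 * (1 - \<phi> x) + (1 - \<phi> x)\<^sup>2) * norm (wgrad B \<phi> x) * u x * v x)"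

definition phase_norm ::
    "'a::euclidean_space set \<Rightarrow> real \<Rightarrow> ('a \<Rightarrow> real) \<Rightarrow> ('a \<Rightarrow> real) \<Rightarrow> real" where
  "phase_norm B \<epsilon> \<phi> u =
     sqrt (LINT x|lebesgue_on B.
        \<phi> x * (norm (wgrad B u x))\<^sup>2 + (1 - \<phi> x) * \<bar>u x\<bar>\<^sup>2 / \<epsilon> ^ 3)"

definition coercive_on ::
    "('a \<Rightarrow> real) set \<Rightarrow> (('a \<Rightarrow> real) \<Rightarrow> real) \<Rightarrow> (('a \<Rightarrow> real) \<Rightarrow> ('a \<Rightarrow> real) \<Rightarrow> real) \<Rightarrow> bool" where
  "coercive_on V N a \<longleftrightarrow> (\<exists>C>0. \<forall>u\<in>V. a u u \<ge> C * (N u)\<^sup>2)"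

end

theory Submission
  imports Defs
begin

text \<open>
  By the product rule, \<open>D \<nabla>u \<bullet> \<nabla>(\<phi>u) = D (\<phi> |\<nabla>u|\<^sup>2 + u \<nabla>u \<bullet> \<nabla>\<phi>)\<close> almost everywhere, and
  \<open>\<nabla>\<phi> = - (6 / \<epsilon>) \<phi> (1 - \<phi>) \<nabla>r\<close> with \<open>|\<nabla>r| = 1\<close>. The weight of \<open>|\<nabla>\<phi>| u\<^sup>2\<close> in the forms is such
  that the mixed terms complete the square exactly: both integrands equal
  \<open>D (\<phi> |\<nabla>u - q|\<^sup>2 + (1 - \<phi>) u\<^sup>2 / \<epsilon>\<^sup>2 + 9 (1 - \<phi>)\<^sup>3 \<phi> u\<^sup>2 / \<epsilon>\<^sup>2)\<close> with
  \<open>q = (\<kappa> / \<epsilon>) (1 - \<phi>) u \<nabla>r\<close>, where \<open>\<kappa> = 3\<close> for the first form and \<open>\<kappa> = 6\<close> for the second.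
  Since \<open>\<phi> |q|\<^sup>2\<close> is bounded by a multiple of the second summand, this controls the norm.

  As \<open>\<phi>\<close> is merely Lipschitz, its classical gradient is identified with the weak one by passing to
  the limit in discrete integration by parts. The product rule for \<open>\<phi>u\<close> needs no mollification:
  it holds for test functions \<open>\<psi>\<close> in place of \<open>u\<close>, by testing the weak gradient of \<open>\<phi>\<close> with
  \<open>\<psi>\<zeta>\<close>, and passes to the limit by density.
\<close>

section \<open>Smooth bump functions\<close>

lemma Ck_const: "Ck k (\<lambda>x::'a::euclidean_space. c)"
  by (induction k arbitrary: c) (auto simp: frechet_derivative_const)

lemma Ck_SucD: "Ck (Suc k) f \<Longrightarrow> Ck k f"
proof (induction k arbitrary: f)
  case 0
  then show ?case
    by (auto simp: continuous_on_eq_continuous_within intro: differentiable_imp_continuous_within)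
next
  case (Suc k)
  then show ?case by (metis Ck.simps(2))
qed

lemma Ck_imp_continuous_on: "Ck k f \<Longrightarrow> continuous_on UNIV f"
  by (induction k) (auto dest: Ck_SucD simp del: Ck.simps(2))

lemma frechet_derivative_plus_at:
  assumes "f differentiable (at x)" "g differentiable (at x)"
  shows "frechet_derivative (\<lambda>y. f y + g y) (at x) b
    = frechet_derivative f (at x) b + frechet_derivative g (at x) b"
  by (subst frechet_derivative_at[OF has_derivative_add, symmetric])
     (use assms frechet_derivative_works in auto)

lemma frechet_derivative_times_at:
  fixes f g :: "'a::euclidean_space \<Rightarrow> real"
  assumes "f differentiable (at x)" "g differentiable (at x)"
  shows "frechet_derivative (\<lambda>y. f y * g y) (at x) b
    = f x * frechet_derivative g (at x) b + frechet_derivative f (at x) b * g x"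
  by (subst frechet_derivative_at[OF has_derivative_mult, symmetric])
     (use assms frechet_derivative_works in auto)

lemma Ck_add: "Ck k f \<Longrightarrow> Ck k g \<Longrightarrow> Ck k (\<lambda>x. f x + g x)"
  by (induction k arbitrary: f g)
     (auto intro: continuous_on_add simp: frechet_derivative_plus_at)

lemma Ck_mult: "Ck k f \<Longrightarrow> Ck k g \<Longrightarrow> Ck k (\<lambda>x. f x * g x)"
proof (induction k arbitrary: f g)
  case 0
  then show ?case by (auto intro: continuous_on_mult)
next
  case (Suc k)
  \<comment> \<open>Each Leibniz term keeps one undifferentiated factor, so the induction hypothesis
    is also applied to \<open>f\<close> and \<open>g\<close> themselves, at level
    \<open>k\<close>.\<close>
  have f: "Ck k f" and g: "Ck k g"
    using Suc.prems by (auto dest: Ck_SucD simp del: Ck.simps)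
  show ?case
    using Suc.prems
    by (auto simp: frechet_derivative_times_at intro!: Ck_add Suc.IH f g)
qed

lemma Ck_prod:
  "finite I \<Longrightarrow> (\<And>i. i \<in> I \<Longrightarrow> Ck k (f i)) \<Longrightarrow> Ck k (\<lambda>x. \<Prod>i\<in>I. f i x)"
  by (induction I rule: finite_induct) (auto intro: Ck_const Ck_mult)

text \<open>The polynomial parameter makes the class stable under differentiation:
  \<open>flat 1\<close> is the classical function exp(-1/x), and its derivatives of every order are
  again of the form \<open>flat p\<close>.\<close>

definition flat :: "real poly \<Rightarrow> real \<Rightarrow> real" where
  "flat p x = (if x > 0 then poly p (1 / x) * exp (- 1 / x) else 0)"

lemma tendsto_poly_div_exp_0: "((\<lambda>t. poly p t / exp t) \<longlongrightarrow> (0::real)) at_top"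
proof -
  have "((\<lambda>t. \<Sum>i\<le>degree p. coeff p i * (t ^ i / exp t)) \<longlongrightarrow> (\<Sum>i\<le>degree p. coeff p i * 0)) at_top"
    by (intro tendsto_sum tendsto_mult tendsto_const tendsto_power_div_exp_0)
  then show ?thesis
    by (simp add: poly_altdef sum_divide_distrib)
qed

lemma flat_tendsto_0: "(flat p \<longlongrightarrow> 0) (at 0)"
proof -
  \<comment> \<open>The substitution t = 1/x turns the right-hand limit at 0 into the decay of a
    polynomial over exp t at infinity.\<close>
  have "((\<lambda>x. poly p (1 / x) / exp (1 / x)) \<longlongrightarrow> 0) (at_right 0)"
    using filterlim_compose[OF tendsto_poly_div_exp_0 filterlim_inverse_at_top_right, of p]
    by (simp add: divide_inverse)
  then have "(flat p \<longlongrightarrow> 0) (at_right 0)"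
    by (rule Lim_transform_eventually)
       (auto simp: eventually_at_right_less flat_def exp_minus field_simps
         intro!: eventually_at_rightI[of 0 1])
  moreover have "(flat p \<longlongrightarrow> 0) (at_left 0)"
    by (rule tendsto_eventually) (auto simp: flat_def intro!: eventually_at_leftI[of "-1"])
  ultimately show ?thesis
    using filterlim_split_at by blast
qed

text \<open>For x > 0 the chain rule for 1/x contributes the factor 1/x^2, hence
  \<open>monom 1 2\<close>; differentiating exp(-1/x) gives \<open>p\<close>, differentiating the
  polynomial gives \<open>- pderiv p\<close>. At 0 the difference quotient is itself a flat
  function, whose limit is already known.\<close>

lemma flat_has_derivative:
  "(flat p has_real_derivative flat (monom 1 2 * (p - pderiv p)) x) (at x)"
proof -
  consider "x > 0" | "x < 0" | "x = 0" by linarith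
  then show ?thesis
  proof cases
    case 1
    have "((\<lambda>x. poly p (1 / x) * exp (- 1 / x)) has_real_derivative
        flat (monom 1 2 * (p - pderiv p)) x) (at x)"
      using 1
      by (auto intro!: derivative_eq_intros DERIV_chain'[OF _ poly_DERIV]
          simp: flat_def poly_monom field_simps power2_eq_square)
    then show ?thesis
      by (rule has_field_derivative_transform_within_open[where S="{0<..}"])
         (use 1 in \<open>auto simp: flat_def\<close>)
  next
    case 2
    have "((\<lambda>x. 0) has_real_derivative flat (monom 1 2 * (p - pderiv p)) x) (at x)"
      using 2 by (simp add: flat_def)
    then show ?thesis
      by (rule has_field_derivative_transform_within_open[where S="{..<0}"])
         (use 2 in \<open>auto simp: flat_def\<close>)
  next
    case 3
    have "flat p h / h = flat ([:0, 1:] * p) h" for h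
      by (simp add: flat_def)
    then show ?thesis
      using flat_tendsto_0[of "[:0, 1:] * p"]
      by (simp add: has_field_derivative_iff 3 flat_def[of _ 0])
  qed
qed

text \<open>A directional derivative multiplies by a constant and replaces the polynomial by another
  one, so the induction runs over all \<open>p\<close> simultaneously.\<close>

lemma Ck_flat_affine: "Ck k (\<lambda>x::'a::euclidean_space. flat p (x \<bullet> v + c))"
proof (induction k arbitrary: p)
  case 0
  have "continuous_on UNIV (flat p)"
    using flat_has_derivative by (meson DERIV_isCont continuous_at_imp_continuous_on)
  then show ?case
    by (auto intro!: continuous_intros continuous_on_compose2[of UNIV "flat p"])
next
  case (Suc k)
  let ?q = "monom 1 2 * (p - pderiv p)"
  have der: "((\<lambda>x. flat p (x \<bullet> v + c)) has_derivative
      (\<lambda>h. flat ?q (x \<bullet> v + c) * (h \<bullet> v))) (at x)" for x :: 'a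
  proof -
    have "(flat p has_derivative (*) (flat ?q (x \<bullet> v + c))) (at (x \<bullet> v + c))"
      using flat_has_derivative has_field_derivative_def by blast
    then show ?thesis
      by (rule has_derivative_compose[rotated]) (auto intro!: derivative_eq_intros)
  qed
  show ?case
    using der by (auto simp: frechet_derivative_at[OF der, symmetric] differentiable_def
        intro!: Ck_mult Ck_const Suc.IH)
qed

text \<open>
  Dilating the factors by \<open>n\<close> turns \<open>exp (- 1 / t)\<close> into \<open>exp (- 1 / (n t))\<close>, so these bumps, all
  supported in the same box, converge to its indicator.
\<close>

definition box_bump :: "'a::euclidean_space \<Rightarrow> 'a \<Rightarrow> nat \<Rightarrow> 'a \<Rightarrow> real" where
  "box_bump a c n x =
     (\<Prod>b\<in>Basis. flat 1 (of_nat (Suc n) * (x \<bullet> b - a \<bullet> b)) * flat 1 (of_nat (Suc n) * (c \<bullet> b - x \<bullet> b)))"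

lemma flat_1_bounds: "0 \<le> flat 1 x" "flat 1 x \<le> 1" "flat 1 x \<noteq> 0 \<longleftrightarrow> x > 0"
  by (auto simp: flat_def)

lemma box_bump_bounds: "0 \<le> box_bump a c n x" "box_bump a c n x \<le> 1"
  unfolding box_bump_def
  by (auto intro!: prod_nonneg prod_le_1 mult_nonneg_nonneg mult_le_one flat_1_bounds)

lemma box_bump_nonzero: "box_bump a c n x \<noteq> 0 \<longleftrightarrow> x \<in> box a c"
  unfolding box_bump_def prod_zero_iff[OF finite_Basis] mem_box
  using flat_1_bounds(3) by (auto simp: zero_less_mult_iff)

lemma Ck_box_bump: "Ck k (box_bump a c n)"
proof -
  have "Ck k (\<lambda>x. \<Prod>b\<in>Basis. flat 1 (x \<bullet> (real (Suc n) *\<^sub>R b) + - (real (Suc n) * (a \<bullet> b)))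
      * flat 1 (x \<bullet> (- real (Suc n) *\<^sub>R b) + real (Suc n) * (c \<bullet> b)))"
    by (intro Ck_prod Ck_mult Ck_flat_affine finite_Basis)
  then show ?thesis
    unfolding box_bump_def[abs_def] by (simp add: algebra_simps)
qed

lemma box_bump_test_function:
  assumes "cbox a c \<subseteq> S"
  shows "box_bump a c n \<in> test_functions S"
proof -
  have "{x. box_bump a c n x \<noteq> 0} = box a c"
    using box_bump_nonzero by auto
  moreover have "closure (box a c) \<subseteq> cbox a c"
    by (intro closure_minimal box_subset_cbox closed_cbox)
  ultimately show ?thesis
    using assms Ck_box_bump by (auto simp: test_functions_def)
qed

lemma flat_1_tendsto: 
  assumes "t > 0" shows "(\<lambda>n. flat 1 (of_nat (Suc n) * t)) \<longlonglongrightarrow> 1"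
proof -
  have "(\<lambda>n. exp (- (1 / t) * (1 / real (Suc n)))) \<longlonglongrightarrow> exp (- (1 / t) * 0)"
    by (intro tendsto_intros LIMSEQ_Suc lim_1_over_n)
  then show ?thesis
    using assms by (simp add: flat_def mult.commute)
qed

lemma box_bump_tendsto: "(\<lambda>n. box_bump a c n x) \<longlonglongrightarrow> indicator (box a c) x"
proof (cases "x \<in> box a c")
  case True
  have "(\<lambda>n. box_bump a c n x) \<longlonglongrightarrow> (\<Prod>b\<in>(Basis::'a set). 1 * 1)"
    unfolding box_bump_def using True
    by (intro tendsto_prod tendsto_mult flat_1_tendsto) (auto simp: mem_box)
  then show ?thesis using True by simp
next
  case False
  then have "box_bump a c n x = 0" for n
    using box_bump_nonzero by blast
  then show ?thesis using False by simp
qed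

section \<open>Uniqueness of weak gradients\<close>

lemma test_function_support:
  assumes "\<psi> \<in> test_functions S"
  obtains K where "compact K" "K \<subseteq> S" "\<And>x. x \<notin> K \<Longrightarrow> \<psi> x = 0"
    "\<And>x b. x \<notin> K \<Longrightarrow> frechet_derivative \<psi> (at x) b = 0"
proof
  let ?K = "closure {x. \<psi> x \<noteq> 0}"
  show "compact ?K" "?K \<subseteq> S"
    using assms by (auto simp: test_functions_def)
  show zero: "\<psi> x = 0" if "x \<notin> ?K" for x
    using that closure_subset[of "{x. \<psi> x \<noteq> 0}"] by auto
  show "frechet_derivative \<psi> (at x) b = 0" if "x \<notin> ?K" for x b
  proof -
    \<comment> \<open>Off the closed support the function vanishes on an open neighbourhood, so one
      compact set serves both the function and its derivative.\<close>
    have "(\<psi> has_derivative (\<lambda>h. 0)) (at x)"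
    proof (rule has_derivative_transform_within_open[OF has_derivative_const])
      show "open (- ?K)" by (simp add: open_Compl)
      show "x \<in> - ?K" using that by blast
      show "0 = \<psi> y" if "y \<in> - ?K" for y
        using zero[of y] that by auto
    qed
    from frechet_derivative_at[OF this] show ?thesis
      by (simp add: fun_eq_iff)
  qed
qed

lemma test_function_continuous: "\<psi> \<in> test_functions S \<Longrightarrow> continuous_on T \<psi>"
  unfolding test_functions_def
  using Ck_imp_continuous_on[of 0] continuous_on_subset by blast

lemma test_function_differentiable: "\<psi> \<in> test_functions S \<Longrightarrow> \<psi> differentiable (at x)"
  unfolding test_functions_def using Ck.simps(2)[of 0 \<psi>] by blast

lemma test_function_continuous_deriv:
  assumes "\<psi> \<in> test_functions S" "b \<in> Basis"
  shows "continuous_on T (\<lambda>x. frechet_derivative \<psi> (at x) b)"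
proof -
  have "Ck (Suc 0) \<psi>"
    using assms(1) by (simp only: test_functions_def mem_Collect_eq)
  then show ?thesis
    using assms(2) continuous_on_subset[OF _ subset_UNIV] by auto
qed

lemma continuous_compact_support_bounded:
  fixes f :: "'a::euclidean_space \<Rightarrow> real"
  assumes "continuous_on UNIV f" "compact K" "\<forall>x. x \<notin> K \<longrightarrow> f x = 0"
  shows "\<exists>M>0. \<forall>x. \<bar>f x\<bar> \<le> M"
proof -
  have "bounded (f ` K)"
    using assms continuous_on_subset[OF assms(1) subset_UNIV]
    by (intro compact_imp_bounded compact_continuous_image)
  then obtain M where M: "M > 0" "\<forall>y\<in>f ` K. norm y \<le> M"
    unfolding bounded_pos by blast
  have "\<bar>f x\<bar> \<le> M" for x
    using M assms(3) by (cases "x \<in> K") auto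
  with M(1) show ?thesis by blast
qed

lemma test_function_bounded:
  assumes "\<psi> \<in> test_functions S"
  shows "\<exists>M>0. \<forall>x. \<bar>\<psi> x\<bar> \<le> M"
proof -
  obtain K where K: "compact K" "K \<subseteq> S" "\<And>x. x \<notin> K \<Longrightarrow> \<psi> x = 0"
    "\<And>x b. x \<notin> K \<Longrightarrow> frechet_derivative \<psi> (at x) b = 0"
    by (rule test_function_support[OF assms]) (rule that)
  show ?thesis
    using K by (intro continuous_compact_support_bounded[OF test_function_continuous[OF assms] K(1)])
      blast
qed

lemma test_function_deriv_bounded:
  assumes "\<psi> \<in> test_functions S"
  shows "\<exists>M>0. \<forall>x. \<forall>b\<in>Basis. \<bar>frechet_derivative \<psi> (at x) b\<bar> \<le> M"
proof -
  obtain K where K: "compact K" "K \<subseteq> S" "\<And>x. x \<notin> K \<Longrightarrow> \<psi> x = 0"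
    "\<And>x b. x \<notin> K \<Longrightarrow> frechet_derivative \<psi> (at x) b = 0"
    by (rule test_function_support[OF assms]) (rule that)
  have "\<forall>b\<in>Basis. \<exists>M>0. \<forall>x. \<bar>frechet_derivative \<psi> (at x) b\<bar> \<le> M"
    using K by (intro ballI continuous_compact_support_bounded[OF
          test_function_continuous_deriv[OF assms] K(1)]) blast+
  then obtain M where "\<forall>b\<in>Basis. M b > (0::real) \<and> (\<forall>x. \<bar>frechet_derivative \<psi> (at x) b\<bar> \<le> M b)"
    by (rule bchoice[THEN exE])
  then have M: "\<And>b. b \<in> Basis \<Longrightarrow> M b > 0"
    "\<And>b x. b \<in> Basis \<Longrightarrow> \<bar>frechet_derivative \<psi> (at x) b\<bar> \<le> M b"
    by auto
  \<comment> \<open>The sum of the finitely many positive bounds takes the place of their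
    maximum.\<close>
  have "M b \<le> sum M Basis" if "b \<in> Basis" for b
    using M(1) that by (intro member_le_sum) (auto intro: less_imp_le)
  then have "\<bar>frechet_derivative \<psi> (at x) b\<bar> \<le> sum M Basis" if "b \<in> Basis" for x b
    using order_trans[OF M(2)] that by blast
  moreover have "sum M Basis > 0"
    using M(1) by (intro sum_pos) auto
  ultimately show ?thesis by blast
qed

lemma test_functions_mult:
  assumes "\<psi> \<in> test_functions S" "\<zeta> \<in> test_functions S"
  shows "(\<lambda>x. \<psi> x * \<zeta> x) \<in> test_functions S"
proof -
  let ?K = "closure {x. \<psi> x \<noteq> 0}" and ?L = "closure {x. \<psi> x * \<zeta> x \<noteq> 0}"
  have K: "compact ?K" "?K \<subseteq> S"
    using assms(1) by (auto simp only: test_functions_def mem_Collect_eq)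
  have "?L \<subseteq> ?K"
    by (intro closure_mono) auto
  then have "compact ?L" "?L \<subseteq> S"
    using compact_Int_closed[OF K(1) closed_closure, of "{x. \<psi> x * \<zeta> x \<noteq> 0}"] K(2)
    by (simp only: Int_absorb1, blast)
  moreover have "\<forall>k. Ck k (\<lambda>x. \<psi> x * \<zeta> x)"
    using assms by (auto simp: test_functions_def intro: Ck_mult)
  ultimately show ?thesis
    unfolding test_functions_def by blast
qed

section \<open>Measurability and local integrability\<close>

lemma continuous_on_UNIV_lebesgue_measurable:
  fixes f :: "'a::euclidean_space \<Rightarrow> 'b::topological_space"
  shows "continuous_on UNIV f \<Longrightarrow> f \<in> borel_measurable lebesgue"
  using borel_measurable_continuous_onI[of f] by (simp add: measurable_completion)

text \<open>Local integrability of \<open>h\<close> is enough: \<psi> is bounded by some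
  \<open>M\<close> and vanishes off \<open>K\<close>, so \<open>M\<close> times the restriction of
  \<open>h\<close> to \<open>K\<close> dominates the product.\<close>

lemma integrable_mult_compact_support:
  fixes h \<psi> :: "'a::euclidean_space \<Rightarrow> real"
  assumes h: "h absolutely_integrable_on K" and K: "compact K" "K \<subseteq> S" "S \<in> sets lebesgue"
    and \<psi>: "continuous_on UNIV \<psi>" "\<And>x. x \<notin> K \<Longrightarrow> \<psi> x = 0"
  shows "integrable (lebesgue_on S) (\<lambda>x. h x * \<psi> x)"
proof -
  obtain M where M: "M > 0" "\<And>x. \<bar>\<psi> x\<bar> \<le> M"
    using continuous_compact_support_bounded[OF \<psi>(1) K(1)] \<psi>(2) by blast
  have int: "integrable lebesgue (\<lambda>x. M * (indicator K x * h x))"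
    using h by (simp add: set_integrable_def)
  have [measurable]: "\<psi> \<in> borel_measurable lebesgue"
    using \<psi>(1) by (rule continuous_on_UNIV_lebesgue_measurable)
  have m: "(\<lambda>x. indicator K x * h x) \<in> borel_measurable lebesgue"
    using h by (simp add: set_integrable_def)
  have "integrable lebesgue (\<lambda>x. (indicator K x * h x) * \<psi> x)"
    by (rule Bochner_Integration.integrable_bound[OF int])
       (use m M in \<open>auto simp: abs_mult mult.commute intro!: AE_I2 mult_right_mono\<close>)
  moreover have "(indicator K x * h x) * \<psi> x = indicator S x *\<^sub>R (h x * \<psi> x)" for x
    using \<psi>(2) K by (auto simp: indicator_def)
  ultimately show ?thesis
    using K by (simp add: integrable_restrict_space)
qed

lemma open_lebesgue: "open S \<Longrightarrow> S \<in> sets lebesgue"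
  by (simp add: borel_open sets_completionI_sets)

text \<open>Local integrability gives measurability on each compact box, and an open set is a
  countable union of such boxes.\<close>

lemma has_weak_gradient_measurable:
  assumes "has_weak_gradient S f g" "open S"
  shows "g \<in> borel_measurable (lebesgue_on S)"
proof -
  obtain \<D> where D: "countable \<D>" "\<D> \<subseteq> Pow S" "\<And>X. X \<in> \<D> \<Longrightarrow> \<exists>a b. X = cbox a b" "\<Union>\<D> = S"
    using open_countable_Union_open_cbox[OF assms(2)] by blast
  have "S \<in> sets lebesgue"
    using assms(2) by (rule open_lebesgue)
  show ?thesis
  proof (rule measurable_piecewise_restrict[OF D(1)])
    show "space (lebesgue_on S) \<subseteq> \<Union> \<D>"
      using D by simp
    fix X assume X: "X \<in> \<D>"
    then obtain a b where ab: "X = cbox a b" using D by blast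
    have XS: "X \<subseteq> S" using X D by blast
    show "X \<inter> space (lebesgue_on S) \<in> sets (lebesgue_on S)"
      using \<open>S \<in> sets lebesgue\<close> XS ab by (auto simp: sets_restrict_space_iff)
    have "g absolutely_integrable_on X"
      using assms(1) XS ab by (auto simp: has_weak_gradient_def)
    then have "g \<in> borel_measurable (lebesgue_on X)"
      using ab by (simp add: absolutely_integrable_measurable)
    then show "g \<in> borel_measurable (restrict_space (lebesgue_on S) X)"
      using \<open>S \<in> sets lebesgue\<close> ab XS by (simp add: restrict_restrict_space Int_absorb1)
  qed
qed

text \<open>A Dynkin argument: boxes are stable under intersection and generate the Borel sets, and
  sets with vanishing integral are closed under complements (thanks to the vanishing total integral)
  and countable disjoint unions. Vanishing on all Borel sets forces the density to be zero.\<close>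

lemma AE_zero_if_box_integrals_zero:
  fixes h :: "'a::euclidean_space \<Rightarrow> real"
  assumes int: "integrable lborel h"
    and UNIV: "(LINT x|lborel. h x) = 0"
    and box: "\<And>a c. (LINT x|lborel. indicator (box a c) x * h x) = 0"
  shows "AE x in lborel. h x = 0"
proof (rule density_unique_real[OF int])
  fix A :: "'a set" assume A: "A \<in> sets lborel"
  let ?G = "range (\<lambda>(a, b). box a b :: 'a set)"
  have int': "integrable lborel (\<lambda>x. indicator A x * h x)" if "A \<in> sets borel" for A :: "'a set"
    using integrable_mult_indicator[OF _ int, of A] that by simp
  have eq: "sigma_sets UNIV ?G = sets (borel :: 'a measure)"
    by (simp add: borel_eq_box)
  have G: "Int_stable ?G"
    by (auto simp: Int_stable_def box_Int_box)
  have "A \<in> sigma_sets UNIV ?G"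
    using A by (simp add: eq)
  with G top_greatest[of ?G, folded Pow_UNIV] have "(LINT x|lborel. indicator A x * h x) = 0"
  proof (induction rule: sigma_sets_induct_disjoint)
    case (compl A)
    have "(LINT x|lborel. indicator (UNIV - A) x * h x)
        = (LINT x|lborel. h x - indicator A x * h x)"
      by (intro Bochner_Integration.integral_cong) (auto simp: indicator_def)
    also have "\<dots> = 0"
      using compl int int' by (simp add: eq UNIV)
    finally show ?case .
  next
    case (union F)
    have F: "F i \<in> sets borel" for i
      using union eq by blast
    have "(LINT x:(\<Union>i. F i)|lborel. h x) = (\<Sum>i. (LINT x:F i|lborel. h x))"
      using F union(1) int
      by (intro lebesgue_integral_countable_add)
         (auto simp: disjoint_family_on_def set_integrable_def intro!: int' sets.countable_UN)
    then show ?case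
      using union by (simp add: set_lebesgue_integral_def)
  qed (auto simp: box)
  then show "(LINT x:A|lborel. h x) = (LINT x:A|lborel. 0)"
    by (simp add: set_lebesgue_integral_def)
qed simp

text \<open>The bumps \<open>box_bump\<close> converge boundedly to the indicator of a box, so
  dominated convergence makes the integral of \<open>h\<close> over every open box whose closed box
  lies in \<open>S\<close> vanish. The Dynkin argument is then applied on one box at a time, and
  countably many boxes exhaust \<open>S\<close>.\<close>

lemma fundamental_lemma_calculus_of_variations:
  fixes h :: "'a::euclidean_space \<Rightarrow> real"
  assumes S: "open S"
    and h: "\<And>K. compact K \<Longrightarrow> K \<subseteq> S \<Longrightarrow> h absolutely_integrable_on K"
    and zero: "\<And>\<psi>. \<psi> \<in> test_functions S \<Longrightarrow> (LINT x|lebesgue_on S. h x * \<psi> x) = 0"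
  shows "AE x in lebesgue_on S. h x = 0"
proof -
  have Sl: "S \<in> sets lebesgue"
    using S by (rule open_lebesgue)
  have box0: "(LINT x|lebesgue. indicator (box a c) x * h x) = 0" if ac: "cbox a c \<subseteq> S" for a c
  proof -
    have hc: "integrable lebesgue (\<lambda>x. indicator (cbox a c) x * h x)"
      using h[OF compact_cbox ac] by (simp add: set_integrable_def)
    have m: "(\<lambda>x. indicator (cbox a c) x * h x) \<in> borel_measurable lebesgue"
      using hc by blast
    have bb: "box_bump a c n x * indicator (cbox a c) x = box_bump a c n x" for n x
      using box_bump_nonzero[of a c n x] box_subset_cbox[of a c] by (auto simp: indicator_def)
    have bm: "box_bump a c n \<in> borel_measurable lebesgue" for n
      using continuous_on_UNIV_lebesgue_measurable[OF Ck_imp_continuous_on[OF Ck_box_bump]] .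
    have lim: "(\<lambda>n. LINT x|lebesgue. box_bump a c n x * (indicator (cbox a c) x * h x))
        \<longlonglongrightarrow> (LINT x|lebesgue. indicator (box a c) x * (indicator (cbox a c) x * h x))"
    proof (rule integral_dominated_convergence[where w="\<lambda>x. norm (indicator (cbox a c) x * h x)"])
      show "AE x in lebesgue. (\<lambda>n. box_bump a c n x * (indicator (cbox a c) x * h x))
          \<longlonglongrightarrow> indicator (box a c) x * (indicator (cbox a c) x * h x)"
        by (intro AE_I2 tendsto_mult box_bump_tendsto tendsto_const)
      show "AE x in lebesgue. norm (box_bump a c n x * (indicator (cbox a c) x * h x))
          \<le> norm (indicator (cbox a c) x * h x)" for n
        using box_bump_bounds[of a c n]
        by (intro AE_I2) (simp add: abs_mult mult_left_le_one_le)
      show "(\<lambda>x. indicator (box a c) x * (indicator (cbox a c) x * h x)) \<in> borel_measurable lebesgue"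
        by (rule borel_measurable_times[OF borel_measurable_indicator[OF open_lebesgue[OF open_box]] m])
      show "(\<lambda>x. box_bump a c n x * (indicator (cbox a c) x * h x)) \<in> borel_measurable lebesgue" for n
        by (rule borel_measurable_times[OF bm m])
      show "integrable lebesgue (\<lambda>x. norm (indicator (cbox a c) x * h x))"
        by (rule integrable_norm[OF hc])
    qed
    have "(LINT x|lebesgue. box_bump a c n x * (indicator (cbox a c) x * h x)) = 0" for n
    proof -
      have "(LINT x|lebesgue. box_bump a c n x * (indicator (cbox a c) x * h x))
          = (LINT x|lebesgue_on S. h x * box_bump a c n x)"
        unfolding integral_restrict_space[OF sets.Int[OF Sl sets.top]]
        using box_bump_nonzero[of a c n] ac box_subset_cbox[of a c]
        by (intro Bochner_Integration.integral_cong) (auto simp: indicator_def)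
      then show ?thesis
        using zero[OF box_bump_test_function[OF ac]] by simp
    qed
    with lim have "(LINT x|lebesgue. indicator (box a c) x * (indicator (cbox a c) x * h x)) = 0"
      by (simp only: LIMSEQ_const_iff)
    moreover have "indicator (box a c) x * (indicator (cbox a c) x * h x)
        = indicator (box a c) x * h x" for x
      using box_subset_cbox[of a c] by (auto simp: indicator_def)
    ultimately show ?thesis
      by simp
  qed
  have AE_cbox: "AE x in lebesgue. x \<in> cbox p q \<longrightarrow> h x = 0" if pq: "cbox p q \<subseteq> S" for p q
  proof -
    let ?h = "\<lambda>x. indicator (box p q) x * h x"
    have int: "integrable lebesgue ?h"
      using set_integrable_subset[OF h[OF compact_cbox pq], of "box p q"] box_subset_cbox[of p q]
      by (simp add: set_integrable_def)
    have hm: "?h \<in> borel_measurable lebesgue"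
      by (rule borel_measurable_integrable[OF int])
    have ib: "indicator (box a c) \<in> borel_measurable lebesgue" for a c :: 'a
      by (rule borel_measurable_indicator[OF open_lebesgue[OF open_box]])
    \<comment> \<open>The Dynkin argument concerns Borel sets and \<open>lborel\<close>, while
      \<open>h\<close> is only Lebesgue measurable; a Borel version agreeing almost everywhere
      bridges the two.\<close>
    obtain h' where h': "h' \<in> borel_measurable lborel" "AE x in lborel. ?h x = h' x"
      using completion_ex_borel_measurable_real int by blast
    have h'l: "h' \<in> borel_measurable lebesgue"
      using h' by (simp add: measurable_completion)
    have AEl: "AE x in lebesgue. ?h x = h' x"
      using h' by (simp add: AE_completion)
    have "integrable lebesgue h'"
      using int AEl h'l integrable_cong_AE_imp[OF int h'l] by auto
    then have int': "integrable lborel h'"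
      using h'(1) integrable_completion by blast
    have "(LINT x|lborel. indicator (box a c) x * h' x) = 0" for a c
    proof -
      have "(LINT x|lborel. indicator (box a c) x * h' x)
          = (LINT x|lebesgue. indicator (box a c) x * h' x)"
        using h'(1) by (intro integral_completion[symmetric]) auto
      also have "\<dots> = (LINT x|lebesgue. indicator (box a c) x * ?h x)"
        by (rule integral_cong_AE[OF borel_measurable_times[OF ib h'l] borel_measurable_times[OF ib hm]])
           (use AEl in \<open>eventually_elim, simp\<close>)
      also have "\<dots> = (LINT x|lebesgue. indicator (box a c \<inter> box p q) x * h x)"
        by (intro Bochner_Integration.integral_cong) (auto simp: indicator_def)
      also have "\<dots> = 0"
      proof (cases "box a c \<inter> box p q = {}")
        case False
        \<comment> \<open>These are the corners of the intersection, which is again an open box and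
          whose closed box stays inside \<open>cbox p q\<close>, so \<open>box0\<close>
          applies.\<close>
        let ?a = "\<Sum>i\<in>Basis. max (a\<bullet>i) (p\<bullet>i) *\<^sub>R i" and ?c = "\<Sum>i\<in>Basis. min (c\<bullet>i) (q\<bullet>i) *\<^sub>R i"
        have "cbox ?a ?c \<subseteq> cbox p q"
          by (auto simp: mem_box)
        then show ?thesis
          using pq unfolding box_Int_box by (intro box0) auto
      qed simp
      finally show ?thesis .
    qed
    moreover have "(LINT x|lborel. h' x) = 0"
    proof -
      have "(LINT x|lborel. h' x) = (LINT x|lebesgue. h' x)"
        using h'(1) by (simp add: integral_completion)
      also have "\<dots> = (LINT x|lebesgue. ?h x)"
        by (rule integral_cong_AE[OF h'l hm]) (use AEl in \<open>eventually_elim, simp\<close>)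
      finally show ?thesis
        using box0[OF pq] by simp
    qed
    ultimately have "AE x in lborel. h' x = 0"
      using AE_zero_if_box_integrals_zero[OF int'] by blast
    then have "AE x in lebesgue. h' x = 0"
      by (rule AE_completion)
    \<comment> \<open>So far \<open>h\<close> is controlled on the open box; the faces of the box
      form a null set.\<close>
    moreover have "AE x in lebesgue. x \<notin> cbox p q - box p q"
      using negligible_frontier_interval[of p q]
      by (intro AE_not_in) (simp add: negligible_iff_null_sets)
    ultimately show ?thesis
      using AEl by eventually_elim (auto simp: indicator_def)
  qed
  \<comment> \<open>With countably many boxes, the union of the exceptional sets is still a null
    set.\<close>
  obtain \<D> where D: "countable \<D>" "\<D> \<subseteq> Pow S" "\<And>X. X \<in> \<D> \<Longrightarrow> \<exists>a b. X = cbox a b" "\<Union>\<D> = S"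
    using open_countable_Union_open_cbox[OF S] by metis
  have "AE x in lebesgue. \<forall>X\<in>\<D>. x \<in> X \<longrightarrow> h x = 0"
    using D AE_cbox by (intro AE_ball_countable') (auto, metis PowD subset_iff)
  then have "AE x in lebesgue. x \<in> S \<longrightarrow> h x = 0"
    by eventually_elim (use D in blast)
  then show ?thesis
    using Sl by (simp add: AE_restrict_space_iff)
qed

lemma absolutely_integrable_inner:
  "g absolutely_integrable_on K \<Longrightarrow> (\<lambda>x. g x \<bullet> b) absolutely_integrable_on K"
  for g :: "'a::euclidean_space \<Rightarrow> 'a"
  unfolding set_integrable_def
  using integrable_inner_left[of b lebesgue "\<lambda>x. indicator K x *\<^sub>R g x"] by auto

lemma has_weak_gradient_integrable_times:
  assumes "has_weak_gradient S f g" "open S" "\<psi> \<in> test_functions S"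
  shows "integrable (lebesgue_on S) (\<lambda>x. (g x \<bullet> b) * \<psi> x)"
proof -
  obtain K where K: "compact K" "K \<subseteq> S" "\<And>x. x \<notin> K \<Longrightarrow> \<psi> x = 0"
    "\<And>x b. x \<notin> K \<Longrightarrow> frechet_derivative \<psi> (at x) b = 0"
    by (rule test_function_support[OF assms(3)]) (rule that)
  show ?thesis
    by (rule integrable_mult_compact_support[OF absolutely_integrable_inner K(1,2)])
       (use assms K test_function_continuous in \<open>auto simp: has_weak_gradient_def\<close>)
qed

text \<open>Both gradients have the same integrals against every test function, so the fundamental
  lemma kills each component of their difference.\<close>

lemma weak_gradient_unique:
  assumes "has_weak_gradient S f g" "has_weak_gradient S f g'" "open S"
  shows "AE x in lebesgue_on S. g x = g' x"
proof -
  have "AE x in lebesgue_on S. (g x - g' x) \<bullet> b = 0" if b: "b \<in> Basis" for b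
  proof (rule fundamental_lemma_calculus_of_variations[OF assms(3)])
    fix K assume "compact K" "K \<subseteq> S"
    then show "(\<lambda>x. (g x - g' x) \<bullet> b) absolutely_integrable_on K"
      using assms by (intro absolutely_integrable_inner set_integral_diff)
        (auto simp: has_weak_gradient_def)
  next
    fix \<psi> assume \<psi>: "\<psi> \<in> test_functions S"
    have eq: "(LINT x|lebesgue_on S. f x * frechet_derivative \<psi> (at x) b)
        = - (LINT x|lebesgue_on S. (k x \<bullet> b) * \<psi> x)" if "has_weak_gradient S f k" for k
      using that \<psi> b unfolding has_weak_gradient_def by blast
    have "(LINT x|lebesgue_on S. (g x \<bullet> b) * \<psi> x) = (LINT x|lebesgue_on S. (g' x \<bullet> b) * \<psi> x)"
      using eq[OF assms(1)] eq[OF assms(2)] by linarith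
    then show "(LINT x|lebesgue_on S. ((g x - g' x) \<bullet> b) * \<psi> x) = 0"
      using has_weak_gradient_integrable_times[OF assms(1,3) \<psi>]
        has_weak_gradient_integrable_times[OF assms(2,3) \<psi>]
      by (simp add: inner_diff_left left_diff_distrib)
  qed
  then have "AE x in lebesgue_on S. \<forall>b\<in>Basis. (g x - g' x) \<bullet> b = 0"
    by (intro AE_ball_countable') (auto intro: countable_finite)
  then show ?thesis
    by eventually_elim (metis euclidean_eqI inner_zero_left right_minus_eq)
qed

section \<open>Calculus with \<open>wgrad\<close>\<close>

lemma has_weak_gradient_wgrad:
  "has_weak_gradient S f g \<Longrightarrow> has_weak_gradient S f (wgrad S f)"
  unfolding wgrad_def by (rule someI[of _ g])

text \<open>By uniqueness the arbitrary choice in \<open>wgrad\<close> is harmless: any explicitly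
  known weak gradient may replace it under an integral.\<close>

lemma wgrad_eq_AE:
  "has_weak_gradient S f g \<Longrightarrow> open S \<Longrightarrow> AE x in lebesgue_on S. wgrad S f x = g x"
  using weak_gradient_unique has_weak_gradient_wgrad by blast

lemma has_weak_gradient_integrable_times_fun:
  assumes "has_weak_gradient S f g" "open S" "\<psi> \<in> test_functions S" "b \<in> Basis"
  shows "integrable (lebesgue_on S) (\<lambda>x. f x * frechet_derivative \<psi> (at x) b)"
proof -
  obtain K where K: "compact K" "K \<subseteq> S" "\<And>x. x \<notin> K \<Longrightarrow> \<psi> x = 0"
    "\<And>x b. x \<notin> K \<Longrightarrow> frechet_derivative \<psi> (at x) b = 0"
    by (rule test_function_support[OF assms(3)]) (rule that)
  show ?thesis
    by (rule integrable_mult_compact_support[OF _ K(1,2)])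
       (use assms K test_function_continuous_deriv open_lebesgue in \<open>auto simp: has_weak_gradient_def\<close>)
qed

lemma has_weak_gradient_diff:
  assumes f: "has_weak_gradient S f g" and f': "has_weak_gradient S f' g'" and S: "open S"
  shows "has_weak_gradient S (\<lambda>x. f x - f' x) (\<lambda>x. g x - g' x)"
proof -
  have "(LINT x|lebesgue_on S. (f x - f' x) * frechet_derivative \<psi> (at x) b)
      = - (LINT x|lebesgue_on S. ((g x - g' x) \<bullet> b) * \<psi> x)"
    if "\<psi> \<in> test_functions S" "b \<in> Basis" for \<psi> b
  proof -
    have eq: "(LINT x|lebesgue_on S. h x * frechet_derivative \<psi> (at x) b)
        = - (LINT x|lebesgue_on S. (k x \<bullet> b) * \<psi> x)" if "has_weak_gradient S h k" for h k
      using that \<open>\<psi> \<in> test_functions S\<close> \<open>b \<in> Basis\<close> unfolding has_weak_gradient_def by blast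
    show ?thesis
      using has_weak_gradient_integrable_times[OF f S that(1), of b]
        has_weak_gradient_integrable_times[OF f' S that(1), of b]
        has_weak_gradient_integrable_times_fun[OF f S that]
        has_weak_gradient_integrable_times_fun[OF f' S that]
      by (simp add: inner_diff_left left_diff_distrib Bochner_Integration.integral_diff
          eq[OF f] eq[OF f'])
  qed
  moreover have "(\<lambda>x. f x - f' x) absolutely_integrable_on K"
    "(\<lambda>x. g x - g' x) absolutely_integrable_on K" if "compact K" "K \<subseteq> S" for K
    using f f' that by (auto simp: has_weak_gradient_def intro: set_integral_diff)
  ultimately show ?thesis
    unfolding has_weak_gradient_def by blast
qed

section \<open>Weak gradients of Lipschitz functions\<close>

lemma has_derivative_quotient_seq:
  fixes f :: "'a::real_normed_vector \<Rightarrow> real"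
  assumes f: "(f has_derivative f') (at x)" and s: "s \<longlonglongrightarrow> 0" "\<And>n. s n \<noteq> 0"
  shows "(\<lambda>n. (f (x + s n *\<^sub>R b) - f x) / s n) \<longlonglongrightarrow> f' b"
proof -
  have "((\<lambda>t. f (x + t *\<^sub>R b)) has_derivative (\<lambda>t. f' (t *\<^sub>R b))) (at 0)"
    by (rule has_derivative_compose[of "\<lambda>t. x + t *\<^sub>R b" "\<lambda>t. t *\<^sub>R b" 0 UNIV f f'])
       (use f in \<open>auto intro!: derivative_eq_intros\<close>)
  moreover have "f' (t *\<^sub>R b) = f' b * t" for t
    using linear_scale[OF has_derivative_linear[OF f]] by simp
  ultimately have "((\<lambda>t. f (x + t *\<^sub>R b)) has_real_derivative f' b) (at 0)"
    by (simp add: has_field_derivative_def)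
  then have "((\<lambda>t. (f (x + t *\<^sub>R b) - f x) / t) \<longlongrightarrow> f' b) (at 0)"
    by (simp add: has_field_derivative_iff)
  then show ?thesis
    by (rule filterlim_compose) (use s in \<open>simp add: filterlim_at\<close>)
qed

lemma integrable_continuous_compact_support:
  fixes f :: "'a::euclidean_space \<Rightarrow> real"
  assumes "continuous_on UNIV f" "compact K" "\<And>x. x \<notin> K \<Longrightarrow> f x = 0"
  shows "integrable lborel f"
proof -
  have "integrable lborel (\<lambda>x. indicator K x *\<^sub>R f x)"
    using assms continuous_on_subset[OF assms(1) subset_UNIV] by (intro borel_integrable_compact)
  moreover have "(\<lambda>x. indicator K x *\<^sub>R f x) = f"
    using assms(3) by (auto simp: indicator_def fun_eq_iff)
  ultimately show ?thesis by simp
qed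

lemma absolutely_integrable_continuous_compact:
  fixes f :: "'a::euclidean_space \<Rightarrow> real"
  assumes "continuous_on UNIV f" "compact K"
  shows "f absolutely_integrable_on K"
proof -
  have "integrable lborel (\<lambda>x. indicator K x *\<^sub>R f x)"
    using assms continuous_on_subset[OF assms(1) subset_UNIV] by (intro borel_integrable_compact)
  then show ?thesis
    unfolding set_integrable_def
    using integrable_completion[OF borel_measurable_integrable] by blast
qed

text \<open>Moves integrals of functions supported in \<open>S\<close> to the whole space, where
  translation invariance is available.\<close>

lemma lebesgue_on_integral_eq_lborel:
  fixes w :: "'a::euclidean_space \<Rightarrow> real"
  assumes "open S" "w \<in> borel_measurable borel" "\<And>x. x \<notin> S \<Longrightarrow> w x = 0"
  shows "(LINT x|lebesgue_on S. w x) = (LINT x|lborel. w x)"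
proof -
  have "(\<lambda>x. indicator S x *\<^sub>R w x) = w"
    using assms(3) by (auto simp: indicator_def fun_eq_iff)
  then have "(LINT x|lebesgue_on S. w x) = (LINT x|lebesgue. w x)"
    using open_lebesgue[OF assms(1)] by (simp add: integral_restrict_space)
  also have "\<dots> = (LINT x|lborel. w x)"
    using assms(2) by (intro integral_completion) simp
  finally show ?thesis .
qed

lemma lborel_integral_translate:
  fixes f :: "'a::euclidean_space \<Rightarrow> real"
  assumes "f \<in> borel_measurable borel"
  shows "(LINT x|lborel. f (c + x)) = (LINT x|lborel. f x)"
proof -
  have "(LINT x|lborel. f x) = (LINT x|distr lborel borel ((+) c). f x)"
    by (simp add: lborel_distr_plus)
  also have "\<dots> = (LINT x|lborel. f (c + x))"
    using assms by (intro integral_distr) auto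
  finally show ?thesis by simp
qed

lemma linear_real_eq_sum_Basis:
  fixes f :: "'a::euclidean_space \<Rightarrow> real"
  assumes "linear f"
  shows "f h = (\<Sum>b\<in>Basis. (h \<bullet> b) * f b)"
proof -
  have "f h = f (\<Sum>b\<in>Basis. (h \<bullet> b) *\<^sub>R b)"
    by (simp add: euclidean_representation)
  also have "\<dots> = (\<Sum>b\<in>Basis. (h \<bullet> b) * f b)"
    by (simp add: linear_sum[OF assms] linear_scale[OF assms])
  finally show ?thesis .
qed

text \<open>A common bound \<open>M\<close> on the partial derivatives bounds the operator norm of
  the derivative by \<open>M\<close> times the dimension; the mean value inequality does the
  rest.\<close>

lemma test_function_lipschitz:
  assumes "\<psi> \<in> test_functions S"
  shows "\<exists>L. L-lipschitz_on UNIV (\<psi> :: 'a::euclidean_space \<Rightarrow> real)"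
proof -
  obtain M where M: "M > 0" "\<And>x b. b \<in> Basis \<Longrightarrow> \<bar>frechet_derivative \<psi> (at x) b\<bar> \<le> M"
    using test_function_deriv_bounded[OF assms] by blast
  have der: "(\<psi> has_derivative frechet_derivative \<psi> (at x)) (at x)" for x
    using test_function_differentiable[OF assms] by (simp add: frechet_derivative_works)
  have "norm (frechet_derivative \<psi> (at x) h) \<le> norm h * (M * DIM('a))" for x h
  proof -
    have lin: "linear (frechet_derivative \<psi> (at x))"
      using der has_derivative_linear by blast
    have "frechet_derivative \<psi> (at x) h = (\<Sum>b\<in>Basis. (h \<bullet> b) * frechet_derivative \<psi> (at x) b)"
      by (rule linear_real_eq_sum_Basis[OF lin])
    also have "\<bar>\<dots>\<bar> \<le> (\<Sum>b\<in>(Basis::'a set). norm h * M)"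
      by (intro order_trans[OF sum_abs] sum_mono)
         (auto simp: abs_mult intro!: mult_mono M Basis_le_norm)
    finally show ?thesis by (simp add: mult_ac)
  qed
  then have "onorm (frechet_derivative \<psi> (at x)) \<le> M * DIM('a)" for x
    by (intro onorm_le) (simp add: mult.commute)
  then have "norm (\<psi> x - \<psi> y) \<le> M * DIM('a) * norm (x - y)" for x y
    using der by (intro differentiable_bound[of UNIV \<psi> "\<lambda>x. frechet_derivative \<psi> (at x)"])
      (auto intro: has_derivative_at_withinI)
  then have "(M * DIM('a))-lipschitz_on UNIV \<psi>"
    using M(1) by (auto simp: lipschitz_on_def dist_norm)
  then show ?thesis by blast
qed

text \<open>Translation invariance moves the difference quotient from \<open>f\<close> to \<psi>.
  Both sides then converge by dominated convergence: one because \<psi> is differentiable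
  everywhere, the other because the quotients of \<open>f\<close> are bounded by \<open>L\<close>
  and converge almost everywhere on \<open>S\<close>.\<close>

lemma lipschitz_integration_by_parts:
  fixes f \<psi> :: "'a::euclidean_space \<Rightarrow> real"
  assumes f: "L-lipschitz_on UNIV f" and \<psi>: "\<psi> \<in> test_functions S" and S: "open S"
    and b: "b \<in> Basis" and G: "G \<in> borel_measurable borel"
    and lim: "AE x in lebesgue_on S.
      (\<lambda>n. (f (x + inverse (real (Suc n)) *\<^sub>R b) - f x) / inverse (real (Suc n))) \<longlonglongrightarrow> G x"
  shows "(LINT x|lebesgue_on S. f x * frechet_derivative \<psi> (at x) b)
    = - (LINT x|lebesgue_on S. G x * \<psi> x)"
proof -
  define t where "t n = inverse (real (Suc n))" for n
  have t: "t n > 0" "t n \<le> 1" "t n \<noteq> 0" for n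
    by (auto simp: t_def field_simps)
  have t0: "t \<longlonglongrightarrow> 0"
    unfolding t_def by (rule LIMSEQ_inverse_real_of_nat)
  obtain K where K: "compact K" "K \<subseteq> S" "\<And>x. x \<notin> K \<Longrightarrow> \<psi> x = 0"
    "\<And>x b. x \<notin> K \<Longrightarrow> frechet_derivative \<psi> (at x) b = 0"
    by (rule test_function_support[OF \<psi>]) (rule that)
  obtain R where R: "\<And>x. x \<in> K \<Longrightarrow> norm x \<le> R"
    using compact_imp_bounded[OF K(1)] by (auto simp: bounded_iff)
  \<comment> \<open>The steps \<open>t n\<close> are at most 1 and \<open>b\<close> is a unit
    vector, so this ball contains the support of \<psi> and of all its translates.\<close>
  let ?C = "cball (0::'a) (R + 1)"
  obtain L' where L': "L'-lipschitz_on UNIV \<psi>"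
    using test_function_lipschitz[OF \<psi>] by blast
  have cf: "continuous_on T f" for T
    using lipschitz_on_continuous_on[OF f] continuous_on_subset by blast
  have c\<psi>: "continuous_on T \<psi>" for T
    using test_function_continuous[OF \<psi>] .
  have bf [measurable]: "f \<in> borel_measurable borel"
    using cf by (rule borel_measurable_continuous_onI)
  have b\<psi> [measurable]: "\<psi> \<in> borel_measurable borel"
    using c\<psi> by (rule borel_measurable_continuous_onI)
  have bd [measurable]: "(\<lambda>x. frechet_derivative \<psi> (at x) b) \<in> borel_measurable borel"
    using test_function_continuous_deriv[OF \<psi> b] by (rule borel_measurable_continuous_onI)
  have cs: "continuous_on UNIV (\<lambda>x. f (x + c))" "continuous_on UNIV (\<lambda>x. \<psi> (x - c))" for c
    by (auto intro!: continuous_on_compose2[OF cf] continuous_on_compose2[OF c\<psi>] continuous_intros)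
  have supp: "\<psi> (x - t n *\<^sub>R b) = 0" "\<psi> x = 0" if "x \<notin> ?C" for x n
  proof -
    have "norm (x - t n *\<^sub>R b) \<ge> norm x - 1"
      using norm_triangle_ineq2[of x "t n *\<^sub>R b"] t[of n] b by simp
    then show "\<psi> (x - t n *\<^sub>R b) = 0" "\<psi> x = 0"
      using that R K(3) by force+
  qed
  have int1: "integrable lborel (\<lambda>x. f x * \<psi> (x - t n *\<^sub>R b))" for n
    by (rule integrable_continuous_compact_support[of _ ?C])
       (use supp in \<open>auto intro!: continuous_on_mult cf cs\<close>)
  have int2: "integrable lborel (\<lambda>x. f x * \<psi> x)"
    by (rule integrable_continuous_compact_support[of _ ?C])
       (use supp in \<open>auto intro!: continuous_on_mult cf c\<psi>\<close>)
  have int3: "integrable lborel (\<lambda>x. f (x + t n *\<^sub>R b) * \<psi> x)" for n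
    by (rule integrable_continuous_compact_support[of _ ?C])
       (use supp in \<open>auto intro!: continuous_on_mult cs c\<psi>\<close>)
  have int4: "integrable lborel (\<lambda>x. \<psi> x)"
    by (rule integrable_continuous_compact_support[of _ ?C])
       (use supp in \<open>auto intro!: c\<psi>\<close>)
  have shift: "(LINT x|lborel. f x * ((\<psi> (x - t n *\<^sub>R b) - \<psi> x) / t n))
      = (LINT x|lborel. (f (x + t n *\<^sub>R b) - f x) / t n * \<psi> x)" for n
  proof -
    \<comment> \<open>Substituting x + t b for x moves the shift onto \<open>f\<close>; the
      unshifted terms are the same on both sides.\<close>
    have "(LINT x|lborel. f (x + t n *\<^sub>R b) * \<psi> x) = (LINT x|lborel. f x * \<psi> (x - t n *\<^sub>R b))"
      using lborel_integral_translate[of "\<lambda>x. f x * \<psi> (x - t n *\<^sub>R b)" "t n *\<^sub>R b"]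
      by (simp add: add.commute)
    then have "(LINT x|lborel. (f x * \<psi> (x - t n *\<^sub>R b) - f x * \<psi> x) / t n)
        = (LINT x|lborel. (f (x + t n *\<^sub>R b) * \<psi> x - f x * \<psi> x) / t n)"
      using int1 int2 int3 by (simp add: Bochner_Integration.integral_diff)
    then show ?thesis
      by (simp add: algebra_simps)
  qed
  obtain Mf where Mf: "\<And>x. x \<in> ?C \<Longrightarrow> \<bar>f x\<bar> \<le> Mf"
  proof -
    have "bounded (f ` ?C)"
      by (intro compact_imp_bounded compact_continuous_image cf) simp
    then obtain a where "\<forall>y\<in>f ` ?C. norm y \<le> a"
      unfolding bounded_iff by blast
    then show ?thesis
      by (intro that[of a]) auto
  qed
  \<comment> \<open>On the ball \<open>f\<close> is bounded by \<open>Mf\<close> and the quotients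
    of \<psi> by \<open>L'\<close>; off the ball everything vanishes.\<close>
  have "(\<lambda>n. LINT x|lborel. f x * ((\<psi> (x - t n *\<^sub>R b) - \<psi> x) / t n))
      \<longlonglongrightarrow> (LINT x|lborel. f x * - frechet_derivative \<psi> (at x) b)"
  proof (rule integral_dominated_convergence[where w="\<lambda>x. Mf * L' * indicator ?C x"])
    \<comment> \<open>The backward shift is a difference quotient with the negative step
      \<open>- t n\<close>; dividing by \<open>t n\<close> instead produces the minus sign of
      integration by parts.\<close>
    have "(\<lambda>n. (\<psi> (x + (- t n) *\<^sub>R b) - \<psi> x) / - t n) \<longlonglongrightarrow> frechet_derivative \<psi> (at x) b" for x
      using t tendsto_minus[OF t0] test_function_differentiable[OF \<psi>]
      by (intro has_derivative_quotient_seq) (auto simp: frechet_derivative_works)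
    from tendsto_minus[OF this]
    have "(\<lambda>n. (\<psi> (x - t n *\<^sub>R b) - \<psi> x) / t n) \<longlonglongrightarrow> - frechet_derivative \<psi> (at x) b" for x
      by simp
    then show "AE x in lborel. (\<lambda>n. f x * ((\<psi> (x - t n *\<^sub>R b) - \<psi> x) / t n))
        \<longlonglongrightarrow> f x * - frechet_derivative \<psi> (at x) b"
      by (intro AE_I2 tendsto_mult tendsto_const)
    show "AE x in lborel. norm (f x * ((\<psi> (x - t n *\<^sub>R b) - \<psi> x) / t n))
        \<le> Mf * L' * indicator ?C x" for n
    proof (rule AE_I2)
      fix x
      show "norm (f x * ((\<psi> (x - t n *\<^sub>R b) - \<psi> x) / t n)) \<le> Mf * L' * indicator ?C x"
      proof (cases "x \<in> ?C")
        case True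
        have "\<bar>\<psi> (x - t n *\<^sub>R b) - \<psi> x\<bar> \<le> L' * t n"
          using lipschitz_onD[OF L', of "x - t n *\<^sub>R b" x] t[of n] b by (simp add: dist_norm)
        then have "\<bar>(\<psi> (x - t n *\<^sub>R b) - \<psi> x) / t n\<bar> \<le> L'"
          using t[of n] by (simp add: field_simps)
        then have "\<bar>f x\<bar> * \<bar>(\<psi> (x - t n *\<^sub>R b) - \<psi> x) / t n\<bar> \<le> Mf * L'"
          using Mf[OF True] by (intro mult_mono) auto
        then show ?thesis
          using True by (simp add: abs_mult)
      qed (simp add: supp)
    qed
    show "integrable lborel (\<lambda>x. Mf * L' * indicator ?C x)"
      using emeasure_lborel_cball_finite[of 0 "R + 1"]
      by (intro integrable_mult_right integrable_real_indicator) simp_all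
  qed measurable
  \<comment> \<open>The quotients of \<open>f\<close> are only known to converge almost everywhere
    on \<open>S\<close>, but elsewhere \<psi> vanishes.\<close>
  moreover have "(\<lambda>n. LINT x|lborel. (f (x + t n *\<^sub>R b) - f x) / t n * \<psi> x)
      \<longlonglongrightarrow> (LINT x|lborel. G x * \<psi> x)"
  proof (rule integral_dominated_convergence[where w="\<lambda>x. L * norm (\<psi> x)"])
    have "AE x in lebesgue. x \<in> S \<longrightarrow> (\<lambda>n. (f (x + t n *\<^sub>R b) - f x) / t n) \<longlonglongrightarrow> G x"
      using lim open_lebesgue[OF S] by (simp add: AE_restrict_space_iff t_def)
    then have "AE x in lborel. x \<in> S \<longrightarrow> (\<lambda>n. (f (x + t n *\<^sub>R b) - f x) / t n) \<longlonglongrightarrow> G x"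
      by (simp add: AE_completion_iff)
    then show "AE x in lborel. (\<lambda>n. (f (x + t n *\<^sub>R b) - f x) / t n * \<psi> x) \<longlonglongrightarrow> G x * \<psi> x"
    proof eventually_elim
      case (elim x)
      show ?case
      proof (cases "x \<in> S")
        case True
        with elim show ?thesis
          by (intro tendsto_mult tendsto_const) blast
      next
        case False
        then have "\<psi> x = 0" using K by blast
        then show ?thesis by simp
      qed
    qed
    show "AE x in lborel. norm ((f (x + t n *\<^sub>R b) - f x) / t n * \<psi> x) \<le> L * norm (\<psi> x)" for n
    proof (rule AE_I2)
      fix x
      have "\<bar>f (x + t n *\<^sub>R b) - f x\<bar> \<le> L * t n"
        using lipschitz_onD[OF f, of "x + t n *\<^sub>R b" x] t[of n] b by (simp add: dist_norm)
      then have "\<bar>(f (x + t n *\<^sub>R b) - f x) / t n\<bar> \<le> L"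
        using t[of n] by (simp add: field_simps)
      then show "norm ((f (x + t n *\<^sub>R b) - f x) / t n * \<psi> x) \<le> L * norm (\<psi> x)"
        unfolding real_norm_def abs_mult by (rule mult_right_mono) simp
    qed
    show "integrable lborel (\<lambda>x. L * norm (\<psi> x))"
      using int4 by (intro integrable_mult_right integrable_norm)
  qed (use G in measurable)
  ultimately have "(LINT x|lborel. f x * - frechet_derivative \<psi> (at x) b) = (LINT x|lborel. G x * \<psi> x)"
    unfolding shift by (rule LIMSEQ_unique)
  moreover have "(LINT x|lebesgue_on S. f x * frechet_derivative \<psi> (at x) b)
      = (LINT x|lborel. f x * frechet_derivative \<psi> (at x) b)"
    using K by (intro lebesgue_on_integral_eq_lborel[OF S]) auto
  moreover have "(LINT x|lebesgue_on S. G x * \<psi> x) = (LINT x|lborel. G x * \<psi> x)"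
    using K G by (intro lebesgue_on_integral_eq_lborel[OF S]) auto
  ultimately show ?thesis
    by simp
qed

text \<open>Limits along the fixed sequence 1/(n+1) make this Borel measurable for every continuous
  \<open>f\<close>, with no prior knowledge of where \<open>f\<close> is differentiable. It is the
  gradient wherever one exists; elsewhere \<open>lim\<close> may return an arbitrary value.\<close>

definition dq_gradient :: "('a::euclidean_space \<Rightarrow> real) \<Rightarrow> 'a \<Rightarrow> 'a" where
  "dq_gradient f x = (\<Sum>b\<in>Basis.
     lim (\<lambda>n. (f (x + inverse (real (Suc n)) *\<^sub>R b) - f x) / inverse (real (Suc n))) *\<^sub>R b)"

lemma GDERIV_quotient_seq:
  assumes "GDERIV f x :> g"
  shows "(\<lambda>n. (f (x + inverse (real (Suc n)) *\<^sub>R b) - f x) / inverse (real (Suc n))) \<longlonglongrightarrow> g \<bullet> b"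
  using has_derivative_quotient_seq[OF assms[unfolded gderiv_def] LIMSEQ_inverse_real_of_nat]
  by (simp add: inner_commute)

lemma dq_gradient_eq:
  assumes "GDERIV f x :> g"
  shows "dq_gradient f x = g"
  unfolding dq_gradient_def limI[OF GDERIV_quotient_seq[OF assms]]
  by (rule euclidean_representation)

lemma borel_measurable_dq_gradient:
  assumes "continuous_on UNIV f"
  shows "dq_gradient f \<in> borel_measurable borel"
proof -
  have [measurable]: "f \<in> borel_measurable borel"
    using assms by (rule borel_measurable_continuous_onI)
  show ?thesis
    unfolding dq_gradient_def[abs_def] by measurable
qed

text \<open>Each partial derivative is a limit of quotients bounded by \<open>L\<close>, and the
  Euclidean norm is at most the sum of the components. This crude constant suffices for
  integrability.\<close>

lemma GDERIV_norm_le_lipschitz: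
  fixes f :: "'a::euclidean_space \<Rightarrow> real" and L :: real
  assumes "L-lipschitz_on UNIV f" "GDERIV f x :> g"
  shows "norm g \<le> DIM('a) * L"
proof -
  have "\<bar>g \<bullet> b\<bar> \<le> L" if b: "b \<in> Basis" for b
  proof (rule LIMSEQ_le_const2[OF tendsto_rabs[OF GDERIV_quotient_seq[OF assms(2)]]], intro exI allI impI)
    fix n
    have "\<bar>f (x + inverse (real (Suc n)) *\<^sub>R b) - f x\<bar> \<le> L * inverse (real (Suc n))"
      using lipschitz_onD[OF assms(1), of "x + inverse (real (Suc n)) *\<^sub>R b" x] b
      by (simp add: dist_norm)
    then show "\<bar>(f (x + inverse (real (Suc n)) *\<^sub>R b) - f x) / inverse (real (Suc n))\<bar> \<le> L"
      unfolding abs_divide by (subst pos_divide_le_eq) auto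
  qed
  then have "(\<Sum>b\<in>Basis. \<bar>g \<bullet> b\<bar>) \<le> (\<Sum>b\<in>(Basis::'a set). L)"
    by (intro sum_mono)
  then show ?thesis
    using norm_le_l1[of g] by simp
qed

lemma lipschitz_dq_gradient_bound:
  fixes f :: "'a::euclidean_space \<Rightarrow> real" and L :: real
  assumes "L-lipschitz_on UNIV f" "AE x in M. \<exists>g. GDERIV f x :> g"
  shows "AE x in M. norm (dq_gradient f x) \<le> DIM('a) * L"
  using assms(2)
  by eventually_elim (auto dest: GDERIV_norm_le_lipschitz[OF assms(1)] simp: dq_gradient_eq)

text \<open>The classical gradient is essentially bounded, hence integrable on compact sets, and it
  is the limit of the difference quotients in \<open>lipschitz_integration_by_parts\<close>.\<close>

lemma lipschitz_has_weak_gradient: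
  fixes f :: "'a::euclidean_space \<Rightarrow> real"
  assumes f: "L-lipschitz_on UNIV f" and S: "open S"
    and ae: "AE x in lebesgue_on S. \<exists>g. GDERIV f x :> g"
  shows "has_weak_gradient S f (dq_gradient f)"
proof -
  have cf: "continuous_on UNIV f"
    using f lipschitz_on_continuous_on by blast
  have m: "dq_gradient f \<in> borel_measurable borel"
    by (rule borel_measurable_dq_gradient[OF cf])
  have "dq_gradient f absolutely_integrable_on K" if K: "compact K" "K \<subseteq> S" for K
  proof -
    have Kl: "K \<in> lmeasurable"
      using K by (simp add: lmeasurable_compact)
    have "AE x in lebesgue. x \<in> S \<longrightarrow> norm (dq_gradient f x) \<le> DIM('a) * L"
      using lipschitz_dq_gradient_bound[OF f ae] open_lebesgue[OF S]
      by (simp add: AE_restrict_space_iff)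
    then have bd: "AE x in lebesgue. norm (indicator K x *\<^sub>R dq_gradient f x)
        \<le> norm (indicator K x *\<^sub>R (DIM('a) * L))"
      by eventually_elim (use K in \<open>auto simp: indicator_def\<close>)
    have "integrable lebesgue (\<lambda>x. indicator K x *\<^sub>R (DIM('a) * L))"
      using Kl by (intro integrable_scaleR_left integrable_real_indicator)
        (simp_all add: fmeasurable_def del: emeasure_completion)
    moreover have "(\<lambda>x. indicator K x *\<^sub>R dq_gradient f x) \<in> borel_measurable lebesgue"
      using m Kl by (intro borel_measurable_scaleR borel_measurable_indicator)
        (auto simp: measurable_completion)
    ultimately show ?thesis
      unfolding set_integrable_def using bd by (rule Bochner_Integration.integrable_bound)
  qed
  moreover have "(LINT x|lebesgue_on S. f x * frechet_derivative \<psi> (at x) b)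
      = - (LINT x|lebesgue_on S. (dq_gradient f x \<bullet> b) * \<psi> x)"
    if "\<psi> \<in> test_functions S" "b \<in> Basis" for \<psi> b
  proof (rule lipschitz_integration_by_parts[OF f that(1) S that(2)])
    show "(\<lambda>x. dq_gradient f x \<bullet> b) \<in> borel_measurable borel"
      using m by simp
    show "AE x in lebesgue_on S. (\<lambda>n. (f (x + inverse (real (Suc n)) *\<^sub>R b) - f x)
        / inverse (real (Suc n))) \<longlonglongrightarrow> dq_gradient f x \<bullet> b"
      using ae
    proof eventually_elim
      case (elim x)
      then obtain g where g: "GDERIV f x :> g" by blast
      show ?case
        unfolding dq_gradient_eq[OF g] by (rule GDERIV_quotient_seq[OF g])
    qed
  qed
  ultimately show ?thesis
    using absolutely_integrable_continuous_compact[OF cf] by (simp add: has_weak_gradient_def)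
qed

section \<open>The phase field\<close>

text \<open>The segment from \<open>x\<close> to \<open>y\<close> meets the frontier at some
  \<open>z\<close>, which splits its length into pieces at least as long as the two distances to the
  frontier. The second bound is a matter of sign: the signed distance is nonpositive at
  \<open>x\<close> and nonnegative at \<open>y\<close>.\<close>

lemma signed_distance_diff_le:
  assumes "x \<in> S" "y \<notin> S"
  shows "signed_distance S y - signed_distance S x \<le> dist x y"
    and "signed_distance S x - signed_distance S y \<le> dist x y"
proof -
  have "closed_segment x y \<inter> frontier S \<noteq> {}"
    using assms by (intro connected_Int_frontier connected_segment) (auto intro: ends_in_segment)
  then obtain z where z: "z \<in> closed_segment x y" "z \<in> frontier S"
    by blast
  have "dist x y = dist x z + dist z y"
    using z(1) by (simp add: between_mem_segment[symmetric] between)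
  moreover have "infdist x (frontier S) \<le> dist x z" "infdist y (frontier S) \<le> dist z y"
    using z(2) infdist_le[of z] by (auto simp: dist_commute)
  ultimately show "signed_distance S y - signed_distance S x \<le> dist x y"
    using assms by (simp add: signed_distance_def)
  show "signed_distance S x - signed_distance S y \<le> dist x y"
    using assms infdist_nonneg[of x "frontier S"] infdist_nonneg[of y "frontier S"]
      zero_le_dist[of x y]
    unfolding signed_distance_def by (simp del: zero_le_dist)
qed

lemma signed_distance_lipschitz: "1-lipschitz_on UNIV (signed_distance S)"
proof (rule lipschitz_onI)
  fix x y :: 'a
  consider "x \<in> S \<longleftrightarrow> y \<in> S" | "x \<in> S" "y \<notin> S" | "x \<notin> S" "y \<in> S"
    by blast
  then show "dist (signed_distance S x) (signed_distance S y) \<le> 1 * dist x y"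
  proof cases
    case 1
    then show ?thesis
      using infdist_triangle_abs[of x "frontier S" y]
      by (auto simp: signed_distance_def dist_real_def)
  next
    case 2
    then show ?thesis
      using signed_distance_diff_le[OF 2] by (simp add: dist_real_def abs_le_iff)
  next
    case 3
    then show ?thesis
      using signed_distance_diff_le[OF 3(2,1)] by (simp add: dist_real_def dist_commute abs_le_iff)
  qed
qed simp

lemma tanh_lipschitz: "1-lipschitz_on UNIV (tanh :: real \<Rightarrow> real)"
proof (rule lipschitz_onI)
  fix x y :: real
  have "norm (tanh x - tanh y) \<le> 1 * norm (x - y)"
  proof (rule field_differentiable_bound[of UNIV tanh "\<lambda>x. 1 - tanh x ^ 2"])
    show "(tanh has_field_derivative 1 - tanh z ^ 2) (at z within UNIV)" for z :: real
      using cosh_real_pos[of z] by (auto intro!: derivative_eq_intros)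
    show "norm (1 - tanh z ^ 2) \<le> 1" for z :: real
      using tanh_real_bounds[of z] by (simp add: abs_square_le_1 abs_le_iff)
  qed auto
  then show "dist (tanh x) (tanh y) \<le> 1 * dist x y"
    by (simp add: dist_norm)
qed simp

definition phase_field :: "real \<Rightarrow> ('a \<Rightarrow> real) \<Rightarrow> 'a \<Rightarrow> real" where
  "phase_field \<epsilon> r x = 1 / 2 * (1 - tanh (3 * r x / \<epsilon>))"

lemma phase_field_bounds: "0 < phase_field \<epsilon> r x" "phase_field \<epsilon> r x < 1"
  using tanh_real_bounds[of "3 * r x / \<epsilon>"] by (auto simp: phase_field_def)

lemma phase_field_lipschitz:
  fixes r :: "'a::metric_space \<Rightarrow> real"
  assumes "\<epsilon> > 0" "1-lipschitz_on UNIV r"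
  shows "(3 / (2 * \<epsilon>))-lipschitz_on UNIV (phase_field \<epsilon> r)"
proof (rule lipschitz_onI)
  fix x y
  have "\<bar>tanh (3 * r x / \<epsilon>) - tanh (3 * r y / \<epsilon>)\<bar> \<le> \<bar>3 * r x / \<epsilon> - 3 * r y / \<epsilon>\<bar>"
    using lipschitz_onD[OF tanh_lipschitz, of "3 * r x / \<epsilon>" "3 * r y / \<epsilon>"]
    by (simp add: dist_real_def)
  also have "\<dots> = 3 / \<epsilon> * \<bar>r x - r y\<bar>"
  proof -
    have "3 * r x / \<epsilon> - 3 * r y / \<epsilon> = 3 / \<epsilon> * (r x - r y)"
      by (simp add: right_diff_distrib)
    then show ?thesis
      using assms(1) by (simp only: abs_mult) simp
  qed
  also have "\<dots> \<le> 3 / \<epsilon> * dist x y"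
    using assms lipschitz_onD[OF assms(2), of x y]
    by (intro mult_left_mono) (auto simp: dist_real_def)
  finally have "\<bar>tanh (3 * r x / \<epsilon>) - tanh (3 * r y / \<epsilon>)\<bar> \<le> 3 / \<epsilon> * dist x y" .
  moreover have "dist (phase_field \<epsilon> r x) (phase_field \<epsilon> r y)
      = 1 / 2 * \<bar>tanh (3 * r x / \<epsilon>) - tanh (3 * r y / \<epsilon>)\<bar>"
  proof -
    have "\<bar>1 / 2 * (1 - a) - 1 / 2 * (1 - b)\<bar> = 1 / 2 * \<bar>a - b\<bar>" for a b :: real
      by (simp add: abs_if) argo
    then show ?thesis
      unfolding phase_field_def dist_real_def .
  qed
  ultimately show "dist (phase_field \<epsilon> r x) (phase_field \<epsilon> r y) \<le> 3 / (2 * \<epsilon>) * dist x y"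
    by simp
qed (use assms in simp)

lemma GDERIV_phase_field:
  assumes "\<epsilon> > 0" "GDERIV r x :> g"
  shows "GDERIV (phase_field \<epsilon> r) x
    :> (- (6 / \<epsilon> * phase_field \<epsilon> r x * (1 - phase_field \<epsilon> r x))) *\<^sub>R g"
proof -
  let ?T = "tanh (3 * r x / \<epsilon>)"
  have "((\<lambda>t. 1 / 2 * (1 - tanh (3 * t / \<epsilon>))) has_real_derivative
      - (3 / (2 * \<epsilon>)) * (1 - ?T\<^sup>2)) (at (r x))"
    using assms(1) cosh_real_pos[of "3 * r x / \<epsilon>"]
    by (auto intro!: derivative_eq_intros simp: field_simps)
  \<comment> \<open>The phase field and its complement are (1 - T)/2 and (1 + T)/2, so 1 - T^2 is
    four times their product.\<close>
  moreover have "- (3 / (2 * \<epsilon>)) * (1 - ?T\<^sup>2)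
      = - (6 / \<epsilon> * phase_field \<epsilon> r x * (1 - phase_field \<epsilon> r x))"
    using assms(1) by (simp add: phase_field_def field_simps power2_eq_square)
  ultimately have "((\<lambda>t. 1 / 2 * (1 - tanh (3 * t / \<epsilon>))) has_real_derivative
      - (6 / \<epsilon> * phase_field \<epsilon> r x * (1 - phase_field \<epsilon> r x))) (at (r x))"
    by (simp only:)
  from GDERIV_DERIV_compose[OF assms(2) this] show ?thesis
    by (simp only: phase_field_def[abs_def])
qed

section \<open>The product rule\<close>

lemma finite_measure_lebesgue_on_open:
  "open S \<Longrightarrow> bounded S \<Longrightarrow> finite_measure (lebesgue_on S)"
  by (simp add: finite_measure_lebesgue_on lmeasurable_open)

lemma integrable_mult_AE_bounded:
  fixes m v :: "'a \<Rightarrow> real"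
  assumes v: "integrable M v" and m: "m \<in> borel_measurable M" and C: "AE x in M. \<bar>m x\<bar> \<le> C"
  shows "integrable M (\<lambda>x. m x * v x)"
proof (rule Bochner_Integration.integrable_bound)
  show "integrable M (\<lambda>x. C * v x)"
    using v by simp
  show "AE x in M. norm (m x * v x) \<le> norm (C * v x)"
    using C by eventually_elim (auto simp: abs_mult intro!: mult_right_mono)
qed (use v m in auto)

text \<open>
  Young's inequality with a parameter tending to zero at the right speed replaces the
  Cauchy--Schwarz inequality.
\<close>

lemma (in finite_measure) tendsto_integral_mult_L2:
  fixes m v :: "'a \<Rightarrow> real" and w :: "nat \<Rightarrow> 'a \<Rightarrow> real"
  assumes m: "m \<in> borel_measurable M" "AE x in M. \<bar>m x\<bar> \<le> C"
    and v: "integrable M v" and w: "\<And>k. integrable M (w k)"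
    and int: "\<And>k. integrable M (\<lambda>x. (v x - w k x)\<^sup>2)"
    and lim: "(\<lambda>k. LINT x|M. (v x - w k x)\<^sup>2) \<longlonglongrightarrow> 0"
  shows "(\<lambda>k. LINT x|M. m x * w k x) \<longlonglongrightarrow> (LINT x|M. m x * v x)"
proof -
  define I where "I k = (LINT x|M. (v x - w k x)\<^sup>2)" for k
  \<comment> \<open>The added reciprocal keeps \<delta> positive even when the error
    \<open>I k\<close> is zero, while \<open>I k / \<delta> k\<close> is still at most
    \<open>\<delta> k\<close>, which tends to 0.\<close>
  define \<delta> where "\<delta> k = sqrt (I k + inverse (real (Suc k)))" for k
  have I: "I k \<ge> 0" for k
    unfolding I_def by (rule integral_nonneg_AE) simp
  have \<delta>: "\<delta> k > 0" "(\<delta> k)\<^sup>2 = I k + inverse (real (Suc k))" for k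
    using I[of k] by (auto simp: \<delta>_def add_nonneg_pos)
  have "\<delta> \<longlonglongrightarrow> sqrt (0 + 0)"
    unfolding \<delta>_def using lim by (intro tendsto_intros LIMSEQ_inverse_real_of_nat) (simp add: I_def)
  then have "(\<lambda>k. \<bar>C\<bar> * (\<delta> k * measure M (space M) + \<delta> k)) \<longlonglongrightarrow> \<bar>C\<bar> * (0 * measure M (space M) + 0)"
    by (intro tendsto_intros) simp_all
  then have bound: "(\<lambda>k. \<bar>C\<bar> * (\<delta> k * measure M (space M) + \<delta> k)) \<longlonglongrightarrow> 0"
    by simp
  have "norm ((LINT x|M. m x * w k x) - (LINT x|M. m x * v x))
      \<le> \<bar>C\<bar> * (\<delta> k * measure M (space M) + \<delta> k)" for k
  proof -
    have mv: "integrable M (\<lambda>x. m x * v x)" and mw: "integrable M (\<lambda>x. m x * w k x)"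
      using integrable_mult_AE_bounded[OF v m] integrable_mult_AE_bounded[OF w m] by auto
    then have "norm ((LINT x|M. m x * w k x) - (LINT x|M. m x * v x))
        = norm (LINT x|M. m x * w k x - m x * v x)"
      by (simp add: Bochner_Integration.integral_diff)
    also have "\<dots> \<le> (LINT x|M. norm (m x * w k x - m x * v x))"
      by (rule integral_norm_bound)
    also have "\<dots> \<le> (LINT x|M. \<bar>C\<bar> * (\<delta> k + (v x - w k x)\<^sup>2 / \<delta> k))"
    proof (rule integral_mono_AE)
      show "integrable M (\<lambda>x. norm (m x * w k x - m x * v x))"
        using mv mw by simp
      show "integrable M (\<lambda>x. \<bar>C\<bar> * (\<delta> k + (v x - w k x)\<^sup>2 / \<delta> k))"
        using int by simp
      show "AE x in M. norm (m x * w k x - m x * v x) \<le> \<bar>C\<bar> * (\<delta> k + (v x - w k x)\<^sup>2 / \<delta> k)"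
        using m(2)
      proof eventually_elim
        case (elim x)
        have young: "\<bar>t\<bar> \<le> \<delta> k + t\<^sup>2 / \<delta> k" for t
        proof -
          have "0 \<le> (\<bar>t\<bar> - \<delta> k)\<^sup>2 + \<bar>t\<bar> * \<delta> k"
            using \<delta>(1)[of k] by simp
          then have "\<bar>t\<bar> * \<delta> k \<le> \<delta> k * \<delta> k + t\<^sup>2"
            by (simp add: power2_eq_square algebra_simps)
          then have "\<bar>t\<bar> \<le> (\<delta> k * \<delta> k + t\<^sup>2) / \<delta> k"
            using \<delta>(1)[of k] by (simp only: pos_le_divide_eq)
          then show ?thesis
            using \<delta>(1)[of k] by (simp add: add_divide_distrib)
        qed
        have "norm (m x * w k x - m x * v x) = \<bar>m x\<bar> * \<bar>v x - w k x\<bar>"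
          by (simp add: abs_mult[symmetric] right_diff_distrib abs_minus_commute)
        also have "\<dots> \<le> \<bar>C\<bar> * (\<delta> k + (v x - w k x)\<^sup>2 / \<delta> k)"
          using elim young by (intro mult_mono) auto
        finally show ?case .
      qed
    qed
    also have "\<dots> = \<bar>C\<bar> * (\<delta> k * measure M (space M) + I k / \<delta> k)"
      using int by (simp add: I_def)
    also have "\<dots> \<le> \<bar>C\<bar> * (\<delta> k * measure M (space M) + \<delta> k)"
    proof (intro mult_left_mono add_left_mono)
      have "I k \<le> \<delta> k * \<delta> k"
        using \<delta>(2)[of k] by (simp add: power2_eq_square)
      then show "I k / \<delta> k \<le> \<delta> k"
        using \<delta>(1)[of k] by (simp add: pos_divide_le_eq)
    qed simp
    finally show ?thesis .
  qed
  then have "(\<lambda>k. (LINT x|M. m x * w k x) - (LINT x|M. m x * v x)) \<longlonglongrightarrow> 0"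
    by (intro Lim_null_comparison[OF _ bound]) (simp add: eventually_sequentially)
  then show ?thesis
    by (simp add: LIM_zero_iff)
qed

section \<open>Test functions and their density in \<open>H1_0\<close>\<close>

lemma test_function_GDERIV:
  assumes "\<psi> \<in> test_functions S"
  shows "GDERIV \<psi> x :> dq_gradient \<psi> x"
    and "b \<in> Basis \<Longrightarrow> dq_gradient \<psi> x \<bullet> b = frechet_derivative \<psi> (at x) b"
proof -
  have der: "(\<psi> has_derivative frechet_derivative \<psi> (at x)) (at x)"
    using test_function_differentiable[OF assms] by (simp add: frechet_derivative_works)
  then have lin: "linear (frechet_derivative \<psi> (at x))"
    by (rule has_derivative_linear)
  let ?g = "\<Sum>b\<in>Basis. frechet_derivative \<psi> (at x) b *\<^sub>R b"
  have "frechet_derivative \<psi> (at x) h = h \<bullet> ?g" for h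
  proof -
    have "frechet_derivative \<psi> (at x) h = (\<Sum>b\<in>Basis. (h \<bullet> b) * frechet_derivative \<psi> (at x) b)"
      by (rule linear_real_eq_sum_Basis[OF lin])
    also have "\<dots> = h \<bullet> ?g"
      by (simp add: inner_sum_right mult.commute)
    finally show ?thesis .
  qed
  then have eq: "frechet_derivative \<psi> (at x) = (\<lambda>h. h \<bullet> ?g)"
    by (rule ext)
  have g: "GDERIV \<psi> x :> ?g"
    unfolding gderiv_def by (rule has_derivative_eq_rhs[OF der eq])
  then show "GDERIV \<psi> x :> dq_gradient \<psi> x"
    by (simp add: dq_gradient_eq)
  show "b \<in> Basis \<Longrightarrow> dq_gradient \<psi> x \<bullet> b = frechet_derivative \<psi> (at x) b"
    unfolding dq_gradient_eq[OF g]
    by (subst inner_commute) (rule fun_cong[OF eq, symmetric])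
qed

lemma test_function_has_weak_gradient:
  assumes "\<psi> \<in> test_functions S" "open S"
  shows "has_weak_gradient S \<psi> (dq_gradient \<psi>)"
proof -
  obtain L where "L-lipschitz_on UNIV \<psi>"
    using test_function_lipschitz[OF assms(1)] by blast
  then show ?thesis
    using test_function_GDERIV(1)[OF assms(1)]
    by (intro lipschitz_has_weak_gradient[OF _ assms(2)]) auto
qed

text \<open>Membership in \<open>H1\<close> provides some square integrable weak gradient;
  uniqueness transfers its integrability to the one chosen by \<open>wgrad\<close>.\<close>

lemma H1_wgrad:
  assumes "u \<in> H1 S" "open S"
  shows "has_weak_gradient S u (wgrad S u)"
    and "wgrad S u \<in> borel_measurable (lebesgue_on S)"
    and "integrable (lebesgue_on S) (\<lambda>x. (norm (wgrad S u x))\<^sup>2)"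
proof -
  obtain g where g: "has_weak_gradient S u g" "integrable (lebesgue_on S) (\<lambda>x. (norm (g x))\<^sup>2)"
    using assms(1) by (auto simp: H1_def)
  show w: "has_weak_gradient S u (wgrad S u)"
    by (rule has_weak_gradient_wgrad[OF g(1)])
  show m: "wgrad S u \<in> borel_measurable (lebesgue_on S)"
    by (rule has_weak_gradient_measurable[OF w assms(2)])
  have "AE x in lebesgue_on S. (norm (g x))\<^sup>2 = (norm (wgrad S u x))\<^sup>2"
    using wgrad_eq_AE[OF g(1) assms(2)] by eventually_elim simp
  then show "integrable (lebesgue_on S) (\<lambda>x. (norm (wgrad S u x))\<^sup>2)"
    using g(2) m by (intro integrable_cong_AE_imp[OF g(2)]) auto
qed

text \<open>The parallelogram identity with the term for the sum dropped.\<close>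

lemma norm_diff_square_le:
  fixes a b :: "'a::real_inner"
  shows "(norm (a - b))\<^sup>2 \<le> 2 * (norm a)\<^sup>2 + 2 * (norm b)\<^sup>2"
proof -
  have "(norm (a - b))\<^sup>2 + (norm (a + b))\<^sup>2 = 2 * (norm a)\<^sup>2 + 2 * (norm b)\<^sup>2"
    by (simp add: power2_norm_eq_inner inner_simps inner_commute)
  then show ?thesis
    using zero_le_power2[of "norm (a + b)"] by linarith
qed

lemma borel_measurable_lebesgue_on:
  "f \<in> borel_measurable borel \<Longrightarrow> f \<in> borel_measurable (lebesgue_on S)"
  by (simp add: measurable_completion measurable_restrict_space1)

lemma (in finite_measure) square_integrable_diff_bounded:
  fixes f g :: "'a \<Rightarrow> 'b::euclidean_space"
  assumes "f \<in> borel_measurable M" "integrable M (\<lambda>x. (norm (f x))\<^sup>2)"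
    and "g \<in> borel_measurable M" "\<And>x. norm (g x) \<le> C"
  shows "integrable M (\<lambda>x. (norm (f x - g x))\<^sup>2)"
proof (rule Bochner_Integration.integrable_bound)
  show "integrable M (\<lambda>x. 2 * (norm (f x))\<^sup>2 + 2 * C\<^sup>2)"
    using assms(2) by simp
  have "(norm (f x - g x))\<^sup>2 \<le> 2 * (norm (f x))\<^sup>2 + 2 * C\<^sup>2" for x
    using norm_diff_square_le[of "f x" "g x"] power_mono[OF assms(4)[of x], of 2] by simp
  then show "AE x in M. norm ((norm (f x - g x))\<^sup>2) \<le> norm (2 * (norm (f x))\<^sup>2 + 2 * C\<^sup>2)"
    by (intro AE_I2) simp
qed (use assms in simp)

text \<open>Unpacks the single norm in the definition of \<open>H1_0\<close> into separate
  convergence of functions and gradients, with the explicit \<open>dq_gradient\<close> of the test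
  functions in place of the chosen \<open>wgrad\<close> of the difference.\<close>

lemma H1_0_approximation:
  fixes S :: "'a::euclidean_space set"
  assumes u: "u \<in> H1_0 S" and S: "open S" "bounded S"
  shows "\<exists>\<psi>. (\<forall>k. \<psi> k \<in> test_functions S) \<and>
    (\<forall>k. integrable (lebesgue_on S) (\<lambda>x. (u x - \<psi> k x)\<^sup>2)) \<and>
    (\<forall>k. integrable (lebesgue_on S) (\<lambda>x. (norm (wgrad S u x - dq_gradient (\<psi> k) x))\<^sup>2)) \<and>
    (\<lambda>k. LINT x|lebesgue_on S. (u x - \<psi> k x)\<^sup>2) \<longlonglongrightarrow> 0 \<and>
    (\<lambda>k. LINT x|lebesgue_on S. (norm (wgrad S u x - dq_gradient (\<psi> k) x))\<^sup>2) \<longlonglongrightarrow> 0"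
proof -
  interpret finite_measure "lebesgue_on S"
    by (rule finite_measure_lebesgue_on_open[OF S])
  have uH1: "u \<in> H1 S"
    using u by (simp add: H1_0_def)
  have um: "u \<in> borel_measurable (lebesgue_on S)" and u2: "integrable (lebesgue_on S) (\<lambda>x. (u x)\<^sup>2)"
    using uH1 by (auto simp: H1_def)
  note wg = H1_wgrad[OF uH1 S(1)]
  obtain \<psi> where \<psi>: "\<And>k::nat. \<psi> k \<in> test_functions S"
    and lim: "(\<lambda>k. H1_norm S (\<lambda>x. u x - \<psi> k x)) \<longlonglongrightarrow> 0"
    using u unfolding H1_0_def by blast
  have \<psi>m: "\<psi> k \<in> borel_measurable (lebesgue_on S)" for k
    using borel_measurable_continuous_onI[OF test_function_continuous[OF \<psi>]]
    by (rule borel_measurable_lebesgue_on)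
  have gm: "dq_gradient (\<psi> k) \<in> borel_measurable (lebesgue_on S)" for k
    using borel_measurable_dq_gradient[OF test_function_continuous[OF \<psi>]]
    by (rule borel_measurable_lebesgue_on)
  have int1: "integrable (lebesgue_on S) (\<lambda>x. (u x - \<psi> k x)\<^sup>2)" for k
  proof -
    obtain M where "\<And>x. \<bar>\<psi> k x\<bar> \<le> M"
      using test_function_bounded[OF \<psi>[of k]] by blast
    then show ?thesis
      using square_integrable_diff_bounded[OF um _ \<psi>m[of k], of M] u2 by simp
  qed
  have int2: "integrable (lebesgue_on S) (\<lambda>x. (norm (wgrad S u x - dq_gradient (\<psi> k) x))\<^sup>2)" for k
  proof -
    obtain L where L: "L-lipschitz_on UNIV (\<psi> k)"
      using test_function_lipschitz[OF \<psi>[of k]] by blast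
    show ?thesis
      by (rule square_integrable_diff_bounded[OF wg(2,3) gm])
         (rule GDERIV_norm_le_lipschitz[OF L test_function_GDERIV(1)[OF \<psi>]])
  qed
  define I where "I k = (LINT x|lebesgue_on S. (u x - \<psi> k x)\<^sup>2)" for k
  define J where "J k = (LINT x|lebesgue_on S. (norm (wgrad S u x - dq_gradient (\<psi> k) x))\<^sup>2)" for k
  have IJ: "I k \<ge> 0" "J k \<ge> 0" for k
    unfolding I_def J_def by (auto intro: integral_nonneg_AE)
  have H1_norm: "H1_norm S (\<lambda>x. u x - \<psi> k x) = sqrt (I k + J k)" for k
  proof -
    \<comment> \<open>Linearity gives an explicit weak gradient of the difference, and uniqueness
      identifies it with the one inside \<open>H1_norm\<close>.\<close>
    have w: "has_weak_gradient S (\<lambda>x. u x - \<psi> k x) (\<lambda>x. wgrad S u x - dq_gradient (\<psi> k) x)"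
      by (rule has_weak_gradient_diff[OF wg(1) test_function_has_weak_gradient[OF \<psi> S(1)] S(1)])
    have "(LINT x|lebesgue_on S. (u x - \<psi> k x)\<^sup>2 + (norm (wgrad S (\<lambda>x. u x - \<psi> k x) x))\<^sup>2)
       = (LINT x|lebesgue_on S. (u x - \<psi> k x)\<^sup>2 + (norm (wgrad S u x - dq_gradient (\<psi> k) x))\<^sup>2)"
    proof (rule integral_cong_AE)
      show "AE x in lebesgue_on S. (u x - \<psi> k x)\<^sup>2 + (norm (wgrad S (\<lambda>x. u x - \<psi> k x) x))\<^sup>2
          = (u x - \<psi> k x)\<^sup>2 + (norm (wgrad S u x - dq_gradient (\<psi> k) x))\<^sup>2"
        using wgrad_eq_AE[OF w S(1)] by eventually_elim simp
      have "wgrad S (\<lambda>x. u x - \<psi> k x) \<in> borel_measurable (lebesgue_on S)"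
        by (rule has_weak_gradient_measurable[OF has_weak_gradient_wgrad[OF w] S(1)])
      then show "(\<lambda>x. (u x - \<psi> k x)\<^sup>2 + (norm (wgrad S (\<lambda>x. u x - \<psi> k x) x))\<^sup>2)
          \<in> borel_measurable (lebesgue_on S)"
        using um \<psi>m[of k] by simp
      show "(\<lambda>x. (u x - \<psi> k x)\<^sup>2 + (norm (wgrad S u x - dq_gradient (\<psi> k) x))\<^sup>2)
          \<in> borel_measurable (lebesgue_on S)"
        using um \<psi>m[of k] wg(2) gm[of k] by simp
    qed
    also have "\<dots> = I k + J k"
      unfolding I_def J_def by (rule Bochner_Integration.integral_add[OF int1 int2])
    finally show ?thesis
      by (simp add: H1_norm_def)
  qed
  \<comment> \<open>Squaring removes the root; both nonnegative summands are then squeezed below a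
    null sequence.\<close>
  have "(\<lambda>k. (sqrt (I k + J k))\<^sup>2) \<longlonglongrightarrow> 0\<^sup>2"
    using lim unfolding H1_norm by (rule tendsto_power)
  then have IJ0: "(\<lambda>k. I k + J k) \<longlonglongrightarrow> 0"
    using IJ by simp
  have "I \<longlonglongrightarrow> 0"
    by (rule tendsto_sandwich[OF _ _ tendsto_const IJ0]) (use IJ in auto)
  moreover have "J \<longlonglongrightarrow> 0"
    by (rule tendsto_sandwich[OF _ _ tendsto_const IJ0]) (use IJ in auto)
  ultimately show ?thesis
    using \<psi> int1 int2 unfolding I_def J_def by blast
qed

lemma lipschitz_times_H1_0_has_weak_gradient:
  fixes f :: "'a::euclidean_space \<Rightarrow> real" and L C :: real
  assumes S: "open S" "bounded S" and f: "L-lipschitz_on UNIV f" and C: "\<And>x. \<bar>f x\<bar> \<le> C"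
    and ae: "AE x in lebesgue_on S. \<exists>g. GDERIV f x :> g" and u: "u \<in> H1_0 S"
  shows "has_weak_gradient S (\<lambda>x. f x * u x)
    (\<lambda>x. f x *\<^sub>R wgrad S u x + u x *\<^sub>R dq_gradient f x)"
proof -
  let ?M = "lebesgue_on S"
  let ?g = "wgrad S u" and ?n = "dq_gradient f"
  interpret finite_measure ?M
    by (rule finite_measure_lebesgue_on_open[OF S])
  have uH1: "u \<in> H1 S"
    using u by (simp add: H1_0_def)
  have um: "u \<in> borel_measurable ?M" and u2: "integrable ?M (\<lambda>x. (u x)\<^sup>2)"
    using uH1 by (auto simp: H1_def)
  note wg = H1_wgrad[OF uH1 S(1)]
  have cf: "continuous_on UNIV f"
    using f lipschitz_on_continuous_on by blast
  have fm: "f \<in> borel_measurable ?M"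
    by (rule borel_measurable_lebesgue_on[OF borel_measurable_continuous_onI[OF cf]])
  have nm: "?n \<in> borel_measurable ?M"
    by (rule borel_measurable_lebesgue_on[OF borel_measurable_dq_gradient[OF cf]])
  have nb: "AE x in ?M. norm (?n x) \<le> DIM('a) * L"
    by (rule lipschitz_dq_gradient_bound[OF f ae])
  \<comment> \<open>On a set of finite measure square integrability implies integrability; bounded
    factors preserve it, so both candidate functions are integrable on all of
    \<open>S\<close>.\<close>
  have u1: "integrable ?M u"
    by (rule square_integrable_imp_integrable[OF um u2])
  have g1: "integrable ?M ?g"
  proof -
    have "integrable ?M (\<lambda>x. norm (?g x))"
      by (rule square_integrable_imp_integrable[OF measurable_compose[OF wg(2) borel_measurable_norm] wg(3)])
    then show ?thesis
      by (simp only: integrable_norm_iff[OF wg(2)])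
  qed
  have fg: "integrable ?M (\<lambda>x. f x *\<^sub>R ?g x)"
    by (rule Bochner_Integration.integrable_bound[of _ "\<lambda>x. C *\<^sub>R ?g x"])
       (use g1 fm wg(2) C in \<open>auto intro!: AE_I2 mult_right_mono order_trans[OF C]\<close>)
  have un: "integrable ?M (\<lambda>x. u x *\<^sub>R ?n x)"
  proof (rule Bochner_Integration.integrable_bound[of _ "\<lambda>x. (DIM('a) * L) * u x"])
    show "AE x in ?M. norm (u x *\<^sub>R ?n x) \<le> norm (DIM('a) * L * u x)"
      using nb
    proof eventually_elim
      case (elim x)
      then have "\<bar>u x\<bar> * norm (?n x) \<le> \<bar>u x\<bar> * \<bar>DIM('a) * L\<bar>"
        by (intro mult_left_mono) auto
      then show ?case
        by (simp add: abs_mult mult_ac)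
    qed
  qed (use u1 um nm in auto)
  have fu: "integrable ?M (\<lambda>x. f x * u x)"
    using C by (intro integrable_mult_AE_bounded[OF u1 fm]) auto
  have loc: "h absolutely_integrable_on K" if "integrable ?M h" "compact K" "K \<subseteq> S"
    for h :: "'a \<Rightarrow> 'c::euclidean_space" and K
  proof -
    have "set_integrable lebesgue S h"
      using that(1) open_lebesgue[OF S(1)] by (simp add: set_integrable_def integrable_restrict_space)
    then show ?thesis
      by (rule set_integrable_subset[OF _ fmeasurableD[OF lmeasurable_compact[OF that(2)]] that(3)])
  qed
  have "(LINT x|?M. f x * u x * frechet_derivative \<zeta> (at x) b)
      = - (LINT x|?M. ((f x *\<^sub>R ?g x + u x *\<^sub>R ?n x) \<bullet> b) * \<zeta> x)"
    if \<zeta>: "\<zeta> \<in> test_functions S" and b: "b \<in> Basis" for \<zeta> b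
  proof -
    let ?d = "\<lambda>\<psi> x. frechet_derivative \<psi> (at x) b"
    obtain \<psi> where \<psi>: "\<And>k. \<psi> k \<in> test_functions S"
      and int1: "\<And>k. integrable ?M (\<lambda>x. (u x - \<psi> k x)\<^sup>2)"
      and int2: "\<And>k. integrable ?M (\<lambda>x. (norm (?g x - dq_gradient (\<psi> k) x))\<^sup>2)"
      and lim1: "(\<lambda>k. LINT x|?M. (u x - \<psi> k x)\<^sup>2) \<longlonglongrightarrow> 0"
      and lim2: "(\<lambda>k. LINT x|?M. (norm (?g x - dq_gradient (\<psi> k) x))\<^sup>2) \<longlonglongrightarrow> 0"
      using H1_0_approximation[OF u S] by blast
    obtain Mz where Mz: "\<And>x. \<bar>\<zeta> x\<bar> \<le> Mz"
      using test_function_bounded[OF \<zeta>] by blast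
    obtain Md where Md: "\<And>x. \<bar>?d \<zeta> x\<bar> \<le> Md"
      using test_function_deriv_bounded[OF \<zeta>] b by blast
    have tm: "\<psi> \<in> borel_measurable ?M" "?d \<psi> \<in> borel_measurable ?M"
      if "\<psi> \<in> test_functions S" for \<psi>
      using test_function_continuous[OF that] test_function_continuous_deriv[OF that b]
      by (auto intro!: borel_measurable_lebesgue_on borel_measurable_continuous_onI)
    have ti: "integrable ?M \<psi>" "integrable ?M (?d \<psi>)" if t: "\<psi> \<in> test_functions S" for \<psi>
    proof -
      obtain M N where "\<And>x. \<bar>\<psi> x\<bar> \<le> M" "\<And>x. \<bar>?d \<psi> x\<bar> \<le> N"
        using test_function_bounded[OF t] test_function_deriv_bounded[OF t] b by blast
      then show "integrable ?M \<psi>" "integrable ?M (?d \<psi>)"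
        using tm[OF t]
        by (auto intro!: AE_I2 integrable_const_bound[of \<psi> M] integrable_const_bound[of "?d \<psi>" N])
    qed
    \<comment> \<open>The facts \<open>m1\<close>, \<open>m2\<close>, \<open>m3\<close> and
      \<open>m3'\<close> supply the bounded multipliers against which the square mean limits of
      \<psi> and of its derivative are taken.\<close>
    have m1: "(\<lambda>x. f x * ?d \<zeta> x) \<in> borel_measurable ?M" "AE x in ?M. \<bar>f x * ?d \<zeta> x\<bar> \<le> C * Md"
      using fm tm[OF \<zeta>] C Md order_trans[OF abs_ge_zero C]
      by (auto simp: abs_mult intro!: AE_I2 mult_mono)
    have m2: "(\<lambda>x. f x * \<zeta> x) \<in> borel_measurable ?M" "AE x in ?M. \<bar>f x * \<zeta> x\<bar> \<le> C * Mz"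
      using fm tm[OF \<zeta>] C Mz order_trans[OF abs_ge_zero C]
      by (auto simp: abs_mult intro!: AE_I2 mult_mono)
    have m3: "(\<lambda>x. (?n x \<bullet> b) * \<zeta> x) \<in> borel_measurable ?M"
      using nm tm[OF \<zeta>] by simp
    have m3': "AE x in ?M. \<bar>(?n x \<bullet> b) * \<zeta> x\<bar> \<le> DIM('a) * L * Mz"
      using nb
    proof eventually_elim
      case (elim x)
      have "\<bar>?n x \<bullet> b\<bar> \<le> DIM('a) * L"
        using elim Basis_le_norm[OF b, of "?n x"] by linarith
      then show ?case
        unfolding abs_mult using Mz by (intro mult_mono) auto
    qed
    have gb: "integrable ?M (\<lambda>x. ?g x \<bullet> b)"
      using g1 by simp
    \<comment> \<open>A component is at most the norm, so convergence of the gradients in square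
      mean passes to each partial derivative.\<close>
    have sq: "((?g x \<bullet> b) - ?d (\<psi> k) x)\<^sup>2 \<le> (norm (?g x - dq_gradient (\<psi> k) x))\<^sup>2" for k x
      using Basis_le_norm[OF b, of "?g x - dq_gradient (\<psi> k) x"]
      by (simp add: inner_diff_left test_function_GDERIV(2)[OF \<psi> b] abs_le_square_iff[symmetric])
    have int3: "integrable ?M (\<lambda>x. ((?g x \<bullet> b) - ?d (\<psi> k) x)\<^sup>2)" for k
      by (rule Bochner_Integration.integrable_bound[OF int2[of k]])
         (use sq wg(2) tm[OF \<psi>[of k]] in auto)
    have "(\<lambda>k. LINT x|?M. ((?g x \<bullet> b) - ?d (\<psi> k) x)\<^sup>2) \<longlonglongrightarrow> 0"
      by (rule tendsto_sandwich[OF _ _ tendsto_const lim2])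
         (auto intro!: always_eventually integral_nonneg_AE integral_mono int3 int2 sq)
    then have L2: "(\<lambda>k. LINT x|?M. f x * \<zeta> x * ?d (\<psi> k) x) \<longlonglongrightarrow> (LINT x|?M. f x * \<zeta> x * (?g x \<bullet> b))"
      by (intro tendsto_integral_mult_L2[OF m2 gb ti(2)[OF \<psi>] int3])
    have L1: "(\<lambda>k. LINT x|?M. f x * ?d \<zeta> x * \<psi> k x) \<longlonglongrightarrow> (LINT x|?M. f x * ?d \<zeta> x * u x)"
      by (rule tendsto_integral_mult_L2[OF m1 u1 ti(1)[OF \<psi>] int1 lim1])
    have L3: "(\<lambda>k. LINT x|?M. (?n x \<bullet> b) * \<zeta> x * \<psi> k x) \<longlonglongrightarrow> (LINT x|?M. (?n x \<bullet> b) * \<zeta> x * u x)"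
      by (rule tendsto_integral_mult_L2[OF m3 m3' u1 ti(1)[OF \<psi>] int1 lim1])
    \<comment> \<open>The product rule with the approximant in place of \<open>u\<close>: the weak
      gradient of \<open>f\<close> is tested with the product of both test functions, whose
      derivative is expanded by Leibniz.\<close>
    have eq: "(LINT x|?M. f x * ?d \<zeta> x * \<psi> k x)
        = - (LINT x|?M. (?n x \<bullet> b) * \<zeta> x * \<psi> k x) - (LINT x|?M. f x * \<zeta> x * ?d (\<psi> k) x)" for k
    proof -
      have t: "(\<lambda>x. \<psi> k x * \<zeta> x) \<in> test_functions S"
        by (rule test_functions_mult[OF \<psi> \<zeta>])
      have "(LINT x|?M. f x * ?d (\<lambda>x. \<psi> k x * \<zeta> x) x) = - (LINT x|?M. (?n x \<bullet> b) * (\<psi> k x * \<zeta> x))"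
        using lipschitz_has_weak_gradient[OF f S(1) ae] t b unfolding has_weak_gradient_def by blast
      moreover have "f x * ?d (\<lambda>x. \<psi> k x * \<zeta> x) x
          = f x * ?d \<zeta> x * \<psi> k x + f x * \<zeta> x * ?d (\<psi> k) x" for x
        using test_function_differentiable[OF \<psi>] test_function_differentiable[OF \<zeta>]
        by (simp add: frechet_derivative_times_at algebra_simps)
      moreover have "(LINT x|?M. f x * ?d \<zeta> x * \<psi> k x + f x * \<zeta> x * ?d (\<psi> k) x)
          = (LINT x|?M. f x * ?d \<zeta> x * \<psi> k x) + (LINT x|?M. f x * \<zeta> x * ?d (\<psi> k) x)"
        by (intro Bochner_Integration.integral_add integrable_mult_AE_bounded[OF _ m1]
            integrable_mult_AE_bounded[OF _ m2] ti[OF \<psi>])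
      ultimately show ?thesis
        by (simp add: mult_ac)
    qed
    have "(\<lambda>k. - (LINT x|?M. (?n x \<bullet> b) * \<zeta> x * \<psi> k x) - (LINT x|?M. f x * \<zeta> x * ?d (\<psi> k) x))
       \<longlonglongrightarrow> - (LINT x|?M. (?n x \<bullet> b) * \<zeta> x * u x) - (LINT x|?M. f x * \<zeta> x * (?g x \<bullet> b))"
      by (intro tendsto_diff tendsto_minus L2 L3)
    then have "(LINT x|?M. f x * ?d \<zeta> x * u x)
        = - (LINT x|?M. (?n x \<bullet> b) * \<zeta> x * u x) - (LINT x|?M. f x * \<zeta> x * (?g x \<bullet> b))"
      using L1 unfolding eq by (rule LIMSEQ_unique[rotated])
    moreover have "(LINT x|?M. ((f x *\<^sub>R ?g x + u x *\<^sub>R ?n x) \<bullet> b) * \<zeta> x)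
        = (LINT x|?M. (?n x \<bullet> b) * \<zeta> x * u x) + (LINT x|?M. f x * \<zeta> x * (?g x \<bullet> b))"
    proof -
      have "(LINT x|?M. ((f x *\<^sub>R ?g x + u x *\<^sub>R ?n x) \<bullet> b) * \<zeta> x)
          = (LINT x|?M. (?n x \<bullet> b) * \<zeta> x * u x + f x * \<zeta> x * (?g x \<bullet> b))"
        by (intro Bochner_Integration.integral_cong) (auto simp: inner_add_left algebra_simps)
      also have "\<dots> = (LINT x|?M. (?n x \<bullet> b) * \<zeta> x * u x) + (LINT x|?M. f x * \<zeta> x * (?g x \<bullet> b))"
        by (intro Bochner_Integration.integral_add integrable_mult_AE_bounded[OF u1 m3 m3']
            integrable_mult_AE_bounded[OF gb m2])
      finally show ?thesis .
    qed
    moreover have "(LINT x|?M. f x * u x * ?d \<zeta> x) = (LINT x|?M. f x * ?d \<zeta> x * u x)"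
      by (simp add: mult_ac)
    ultimately show ?thesis
      by simp
  qed
  moreover have "integrable ?M (\<lambda>x. f x *\<^sub>R ?g x + u x *\<^sub>R ?n x)"
    using fg un by simp
  ultimately show ?thesis
    using loc[OF fu] loc[of "\<lambda>x. f x *\<^sub>R ?g x + u x *\<^sub>R ?n x"]
    unfolding has_weak_gradient_def by blast
qed

section \<open>Coercivity\<close>

text \<open>
  After the product rule, the integrands of \<open>form_a0\<close> and \<open>form_a1\<close> are \<open>D\<close> times this square for
  \<open>\<kappa> = 3\<close> and \<open>\<kappa> = 6\<close>, where \<open>s\<close> is the phase field, \<open>p\<close> the gradient of \<open>u\<close> and \<open>e\<close> the gradient of
  the distance function.
\<close>

definition completed_square :: "real \<Rightarrow> real \<Rightarrow> real \<Rightarrow> real \<Rightarrow> 'a::real_inner \<Rightarrow> 'a \<Rightarrow> real" where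
  "completed_square \<kappa> \<epsilon> s z p e = s * (norm (p - (\<kappa> * (1 - s) * z / \<epsilon>) *\<^sub>R e))\<^sup>2
     + (1 - s) * z\<^sup>2 / \<epsilon>\<^sup>2 + 9 * (1 - s) ^ 3 * s * z\<^sup>2 / \<epsilon>\<^sup>2"

lemma norm_diff_scaleR_square:
  fixes p e :: "'a::real_inner"
  assumes "norm e = 1"
  shows "(norm (p - c *\<^sub>R e))\<^sup>2 = (norm p)\<^sup>2 - 2 * c * (p \<bullet> e) + c\<^sup>2"
proof -
  have "e \<bullet> e = 1"
    using assms by (simp add: dot_square_norm)
  then show ?thesis
    unfolding power2_norm_eq_inner
    by (simp add: inner_diff_left inner_diff_right inner_commute[of e p] power2_eq_square
        algebra_simps)
qed

text \<open>The mixed term has coefficient 6/\<epsilon> = 2 * 3/\<epsilon>, hence \<kappa> = 3. With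
  \<open>norm n\<close> inserted, the \<open>(1 - s)\<close> part of the last weight is 9 s (1 -
  s)^2 z^2 / \<epsilon>^2, exactly what completes the square; the \<open>(1 - s)\<^sup>2\<close>
  part leaves the cubic remainder.\<close>

lemma a0_integrand_eq:
  fixes p e :: "'a::real_inner"
  assumes "\<epsilon> > 0" "norm e = 1" "0 < s" "s < 1"
    and n: "n = (- (6 / \<epsilon> * s * (1 - s))) *\<^sub>R e"
  shows "D * (p \<bullet> (s *\<^sub>R p + z *\<^sub>R n)) + D / \<epsilon>\<^sup>2 * (1 - s) * z * z
      + 3 * D / (2 * \<epsilon>) * ((1 - s) + (1 - s)\<^sup>2) * norm n * z * z
    = D * completed_square 3 \<epsilon> s z p e"
proof -
  have norm: "norm n = 6 / \<epsilon> * s * (1 - s)"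
    using assms by (simp add: abs_mult)
  have inner: "p \<bullet> (s *\<^sub>R p + z *\<^sub>R n) = s * (norm p)\<^sup>2 - z * (6 / \<epsilon> * s * (1 - s)) * (p \<bullet> e)"
    by (simp add: n inner_add_right inner_diff_right power2_norm_eq_inner)
  show ?thesis
    unfolding completed_square_def norm_diff_scaleR_square[OF assms(2)] norm inner
    using assms(1) by (simp add: field_simps power2_eq_square power3_eq_cube)
qed

text \<open>The extra first-order term doubles the mixed term, so \<kappa> = 6 and the completing
  term is 36 s (1 - s)^2 z^2 / \<epsilon>^2; this is what the factor 4 in the weight
  supplies.\<close>

lemma a1_integrand_eq:
  fixes p e :: "'a::real_inner"
  assumes "\<epsilon> > 0" "norm e = 1" "0 < s" "s < 1"
    and n: "n = (- (6 / \<epsilon> * s * (1 - s))) *\<^sub>R e"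
  shows "D * (p \<bullet> (s *\<^sub>R p + z *\<^sub>R n)) + D / \<epsilon>\<^sup>2 * (1 - s) * z * z + D * z * (n \<bullet> p)
      + 3 * D / (2 * \<epsilon>) * (4 * (1 - s) + (1 - s)\<^sup>2) * norm n * z * z
    = D * completed_square 6 \<epsilon> s z p e"
proof -
  have norm: "norm n = 6 / \<epsilon> * s * (1 - s)"
    using assms by (simp add: abs_mult)
  have inner: "p \<bullet> (s *\<^sub>R p + z *\<^sub>R n) = s * (norm p)\<^sup>2 - z * (6 / \<epsilon> * s * (1 - s)) * (p \<bullet> e)"
    by (simp add: n inner_add_right inner_diff_right power2_norm_eq_inner)
  have inner': "n \<bullet> p = - (6 / \<epsilon> * s * (1 - s)) * (p \<bullet> e)"
    by (simp add: n inner_commute)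
  show ?thesis
    unfolding completed_square_def norm_diff_scaleR_square[OF assms(2)] norm inner inner'
    using assms(1) by (simp add: field_simps power2_eq_square power3_eq_cube)
qed

text \<open>Writing p = (p - q) + q costs a factor 2, and the part from q is at most \<kappa>^2
  times the second summand \<open>W\<close>. The norm's own zero-order term is \<open>W\<close>
  divided by \<epsilon>. Since both \<open>A\<close> and \<open>W\<close> are at most the whole
  expression, the factors add up to the constant.\<close>

lemma completed_square_lower:
  fixes p e :: "'a::real_inner"
  assumes "\<epsilon> > 0" "norm e = 1" "0 < s" "s < 1"
  shows "s * (norm p)\<^sup>2 + (1 - s) * z\<^sup>2 / \<epsilon> ^ 3 \<le> (2 + 2 * \<kappa>\<^sup>2 + 1 / \<epsilon>) * completed_square \<kappa> \<epsilon> s z p e"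
proof -
  let ?q = "(\<kappa> * (1 - s) * z / \<epsilon>) *\<^sub>R e"
  define A where "A = s * (norm (p - ?q))\<^sup>2"
  define W where "W = (1 - s) * z\<^sup>2 / \<epsilon>\<^sup>2"
  define Q where "Q = completed_square \<kappa> \<epsilon> s z p e"
  have "Q = A + W + 9 * (1 - s) ^ 3 * s * z\<^sup>2 / \<epsilon>\<^sup>2"
    by (simp add: Q_def A_def W_def completed_square_def)
  moreover have "9 * (1 - s) ^ 3 * s * z\<^sup>2 / \<epsilon>\<^sup>2 \<ge> 0"
    using assms by simp
  moreover have AW: "A \<ge> 0" "W \<ge> 0"
    using assms by (auto simp: A_def W_def)
  ultimately have Q: "A \<le> Q" "W \<le> Q"
    by linarith+
  have "s * (norm p)\<^sup>2 \<le> s * (2 * (norm (p - ?q))\<^sup>2 + 2 * (norm ?q)\<^sup>2)"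
    using norm_diff_square_le[of "p - ?q" "- ?q"] assms by (intro mult_left_mono) auto
  also have "\<dots> = 2 * A + 2 * (s * (norm ?q)\<^sup>2)"
    by (simp add: A_def algebra_simps)
  \<comment> \<open>Of the two factors 1 - s in the square of q, one is absorbed into
    \<open>W\<close>, so the bound stays uniform as s approaches 0 or 1.\<close>
  also have "s * (norm ?q)\<^sup>2 = \<kappa>\<^sup>2 * (s * (1 - s)) * W"
    using assms by (simp add: W_def power_mult_distrib power_divide power2_eq_square)
  also have "\<dots> \<le> \<kappa>\<^sup>2 * 1 * W"
    using assms AW by (intro mult_right_mono mult_left_mono mult_le_one) auto
  finally have "s * (norm p)\<^sup>2 \<le> 2 * A + 2 * (\<kappa>\<^sup>2 * W)"
    by simp
  moreover have "(1 - s) * z\<^sup>2 / \<epsilon> ^ 3 = 1 / \<epsilon> * W"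
    by (simp add: W_def power2_eq_square power3_eq_cube)
  moreover have "\<kappa>\<^sup>2 * W \<le> \<kappa>\<^sup>2 * Q" "1 / \<epsilon> * W \<le> 1 / \<epsilon> * Q"
    using Q assms by (auto intro!: mult_left_mono divide_right_mono)
  ultimately have "s * (norm p)\<^sup>2 + (1 - s) * z\<^sup>2 / \<epsilon> ^ 3 \<le> 2 * Q + 2 * (\<kappa>\<^sup>2 * Q) + 1 / \<epsilon> * Q"
    using Q by linarith
  then show ?thesis
    unfolding Q_def by (simp add: algebra_simps)
qed

text \<open>Provides the integrable majorant and the sign of the form's integrand. The 10 is 1 + 9,
  the coefficients of the two zero-order summands.\<close>

lemma completed_square_upper:
  fixes p e :: "'a::real_inner"
  assumes "\<epsilon> > 0" "norm e = 1" "0 < s" "s < 1"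
  shows "completed_square \<kappa> \<epsilon> s z p e \<le> 2 * (norm p)\<^sup>2 + (2 * \<kappa>\<^sup>2 + 10) / \<epsilon>\<^sup>2 * z\<^sup>2"
    and "0 \<le> completed_square \<kappa> \<epsilon> s z p e"
proof -
  let ?q = "(\<kappa> * (1 - s) * z / \<epsilon>) *\<^sub>R e"
  define W where "W = z\<^sup>2 / \<epsilon>\<^sup>2"
  have W: "W \<ge> 0" by (simp add: W_def)
  define A where "A = s * (norm (p - ?q))\<^sup>2"
  define V where "V = (1 - s) * W"
  define T where "T = (1 - s) ^ 3 * s * W"
  have "A \<le> 1 * (2 * (norm p)\<^sup>2 + 2 * (norm ?q)\<^sup>2)"
    unfolding A_def using norm_diff_square_le[of p ?q] assms by (intro mult_mono) auto
  moreover have "(norm ?q)\<^sup>2 = \<kappa>\<^sup>2 * (1 - s)\<^sup>2 * W"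
    using assms by (simp add: W_def power_mult_distrib power_divide)
  moreover have "\<kappa>\<^sup>2 * (1 - s)\<^sup>2 * W \<le> \<kappa>\<^sup>2 * 1 * W"
    using assms W by (intro mult_right_mono mult_left_mono power_le_one) auto
  ultimately have "A \<le> 2 * (norm p)\<^sup>2 + 2 * (\<kappa>\<^sup>2 * W)"
    by simp
  moreover have "V \<le> 1 * W"
    unfolding V_def using assms W by (intro mult_right_mono) auto
  moreover have "T \<le> 1 * W"
    unfolding T_def using assms W by (intro mult_right_mono mult_le_one power_le_one) auto
  moreover have "completed_square \<kappa> \<epsilon> s z p e = A + V + 9 * T"
    by (simp add: completed_square_def A_def V_def T_def W_def)
  ultimately have "completed_square \<kappa> \<epsilon> s z p e \<le> 2 * (norm p)\<^sup>2 + 2 * (\<kappa>\<^sup>2 * W) + 10 * W"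
    by simp
  then show "completed_square \<kappa> \<epsilon> s z p e \<le> 2 * (norm p)\<^sup>2 + (2 * \<kappa>\<^sup>2 + 10) / \<epsilon>\<^sup>2 * z\<^sup>2"
    by (simp add: W_def algebra_simps add_divide_distrib)
  show "0 \<le> completed_square \<kappa> \<epsilon> s z p e"
    using assms by (simp add: completed_square_def)
qed

text \<open>Integrates the pointwise bounds, with coercivity constant \<open>d / ?K\<close>. The
  unit vector \<open>e\<close> is chosen separately at each point, with no measurability in
  \<open>x\<close>, so measurability is asked of \<open>F u\<close> itself. Coercivity only sees the
  diagonal, so the form may ignore \<open>v\<close>.\<close>

lemma coercive_if_completed_square:
  fixes B :: "'a::euclidean_space set" and F :: "('a \<Rightarrow> real) \<Rightarrow> 'a \<Rightarrow> real"
  assumes B: "open B" and \<epsilon>: "\<epsilon> > 0" and d: "d > 0" "\<And>x. x \<in> B \<Longrightarrow> D x \<ge> d"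
    and M: "\<And>x. x \<in> B \<Longrightarrow> D x \<le> M"
    and \<phi>: "\<phi> \<in> borel_measurable (lebesgue_on B)" "\<And>x. 0 < \<phi> x" "\<And>x. \<phi> x < 1"
    and Fm: "\<And>u. u \<in> H1_0 B \<Longrightarrow> F u \<in> borel_measurable (lebesgue_on B)"
    and F: "\<And>u. u \<in> H1_0 B \<Longrightarrow> AE x in lebesgue_on B.
      \<exists>e. norm e = 1 \<and> F u x = D x * completed_square \<kappa> \<epsilon> (\<phi> x) (u x) (wgrad B u x) e"
  shows "coercive_on (H1_0 B) (phase_norm B \<epsilon> \<phi>) (\<lambda>u v. LINT x|lebesgue_on B. F u x)"
proof -
  let ?M = "lebesgue_on B"
  let ?K = "2 + 2 * \<kappa>\<^sup>2 + 1 / \<epsilon>"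
  have K: "?K > 0"
    using \<epsilon> by (simp add: add_pos_nonneg add_nonneg_pos)
  have "d / ?K * (phase_norm B \<epsilon> \<phi> u)\<^sup>2 \<le> (LINT x|?M. F u x)" if u: "u \<in> H1_0 B" for u
  proof -
    let ?N = "\<lambda>x. \<phi> x * (norm (wgrad B u x))\<^sup>2 + (1 - \<phi> x) * \<bar>u x\<bar>\<^sup>2 / \<epsilon> ^ 3"
    let ?c = "(2 * \<kappa>\<^sup>2 + 10) / \<epsilon>\<^sup>2"
    have uH1: "u \<in> H1 B"
      using u by (simp add: H1_0_def)
    have um: "u \<in> borel_measurable ?M" and u2: "integrable ?M (\<lambda>x. (u x)\<^sup>2)"
      using uH1 by (auto simp: H1_def)
    note wg = H1_wgrad[OF uH1 B]
    have inB: "AE x in ?M. x \<in> B"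
      by (intro AE_I2) simp
    have int: "integrable ?M (\<lambda>x. M * (2 * (norm (wgrad B u x))\<^sup>2 + ?c * (u x)\<^sup>2))"
      using wg(3) u2 by (intro integrable_mult_right integrable_add) auto
    \<comment> \<open>This is essential: a non-integrable integrand would have integral 0 by
      convention, which would ruin the lower bound. The upper bound on \<open>D\<close> enters
      here.\<close>
    have Fint: "integrable ?M (F u)"
    proof (rule Bochner_Integration.integrable_bound[OF int Fm[OF u]])
      show "AE x in ?M. norm (F u x) \<le> norm (M * (2 * (norm (wgrad B u x))\<^sup>2 + ?c * (u x)\<^sup>2))"
        using F[OF u] inB
      proof eventually_elim
        case (elim x)
        then obtain e where e: "norm e = 1"
          "F u x = D x * completed_square \<kappa> \<epsilon> (\<phi> x) (u x) (wgrad B u x) e" by blast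
        note upper = completed_square_upper[OF \<epsilon> e(1) \<phi>(2,3)[of x], of \<kappa> "u x" "wgrad B u x"]
        have D: "0 \<le> D x" "D x \<le> M"
          using d M elim by force+
        have "F u x \<le> M * (2 * (norm (wgrad B u x))\<^sup>2 + ?c * (u x)\<^sup>2)"
          unfolding e(2) using upper D by (intro mult_mono) auto
        moreover have "F u x \<ge> 0"
          unfolding e(2) using upper(2) D by simp
        ultimately show ?case by simp
      qed
    qed
    have low: "AE x in ?M. d / ?K * ?N x \<le> F u x"
      using F[OF u] inB
    proof eventually_elim
      case (elim x)
      then obtain e where e: "norm e = 1"
        "F u x = D x * completed_square \<kappa> \<epsilon> (\<phi> x) (u x) (wgrad B u x) e" by blast
      let ?Q = "completed_square \<kappa> \<epsilon> (\<phi> x) (u x) (wgrad B u x) e"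
      have "?N x \<le> ?K * ?Q"
        using completed_square_lower[OF \<epsilon> e(1) \<phi>(2,3)] by simp
      then have "d / ?K * ?N x \<le> d / ?K * (?K * ?Q)"
        using d(1) K by (intro mult_left_mono divide_nonneg_pos) auto
      also have "\<dots> = d * ?Q"
        using K by simp
      also have "\<dots> \<le> D x * ?Q"
        using completed_square_upper(2)[OF \<epsilon> e(1) \<phi>(2,3)] d(2) elim by (intro mult_right_mono) auto
      finally show ?case
        by (simp only: e(2))
    qed
    have Nnn: "?N x \<ge> 0" for x
      using \<phi>(2,3)[of x] \<epsilon> by simp
    have "(phase_norm B \<epsilon> \<phi> u)\<^sup>2 = (LINT x|?M. ?N x)"
      unfolding phase_norm_def using Nnn by (intro real_sqrt_pow2 integral_nonneg_AE AE_I2)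
    then have "d / ?K * (phase_norm B \<epsilon> \<phi> u)\<^sup>2 = (LINT x|?M. d / ?K * ?N x)"
      by (simp only: integral_mult_right_zero)
    also have "\<dots> \<le> (LINT x|?M. F u x)"
    \<comment> \<open>Here integrability is asked of the larger, nonnegative function alone.\<close>
    proof (rule integral_mono_AE'[OF Fint low])
      show "AE x in ?M. 0 \<le> F u x"
        using low by eventually_elim (use Nnn d(1) K in \<open>auto intro: order_trans[rotated] mult_nonneg_nonneg\<close>)
    qed
    finally show ?thesis .
  qed
  moreover have "d / ?K > 0"
    using d(1) K by simp
  ultimately show ?thesis
    unfolding coercive_on_def by blast
qed

theorem theorem3p2:
  fixes \<Omega> B :: "'a::euclidean_space set"
    and r \<phi> D :: "'a \<Rightarrow> real"
    and \<epsilon> d :: real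
  assumes "bounded_domain \<Omega>" and "C1_boundary \<Omega>"
    and "bounded_domain B" and "\<Omega> \<subset> B"
    and "r = signed_distance \<Omega>"
    and "AE x in lebesgue_on B. \<exists>g. GDERIV r x :> g \<and> norm g = 1"
    and "\<epsilon> > 0"
    and "\<phi> = (\<lambda>x. 1 / 2 * (1 - tanh (3 * r x / \<epsilon>)))"
    and "D \<in> borel_measurable (lebesgue_on B)" and "bounded (D ` B)"
    and "d > 0" and "\<And>x. x \<in> B \<Longrightarrow> D x \<ge> d"
  shows "coercive_on (H1_0 B) (phase_norm B \<epsilon> \<phi>) (form_a0 B \<epsilon> D \<phi>) \<and>
    coercive_on (H1_0 B) (phase_norm B \<epsilon> \<phi>) (form_a1 B \<epsilon> D \<phi>)"
proof -
  let ?M = "lebesgue_on B"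
  have B: "open B" "bounded B"
    using assms(3) by (auto simp: bounded_domain_def)
  have \<phi>: "\<phi> = phase_field \<epsilon> r"
    unfolding assms(8) phase_field_def[abs_def] ..
  have \<phi>01: "0 < \<phi> x" "\<phi> x < 1" for x
    using phase_field_bounds by (auto simp: \<phi>)
  have lip: "(3 / (2 * \<epsilon>))-lipschitz_on UNIV \<phi>"
    unfolding \<phi> assms(5) by (rule phase_field_lipschitz[OF assms(7) signed_distance_lipschitz])
  have "continuous_on UNIV \<phi>"
    using lip lipschitz_on_continuous_on by blast
  then have \<phi>m: "\<phi> \<in> borel_measurable ?M"
    by (intro borel_measurable_lebesgue_on borel_measurable_continuous_onI)
  \<comment> \<open>The unit vector \<open>e\<close> is the gradient of the signed distance.\<close>
  have grad: "AE x in ?M. \<exists>e. norm e = 1 \<and> GDERIV \<phi> x :> (- (6 / \<epsilon> * \<phi> x * (1 - \<phi> x))) *\<^sub>R e"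
    using assms(6) unfolding \<phi> by eventually_elim (use GDERIV_phase_field[OF assms(7)] in blast)
  then have ae: "AE x in ?M. \<exists>g. GDERIV \<phi> x :> g"
    by eventually_elim blast
  have w\<phi>: "has_weak_gradient B \<phi> (dq_gradient \<phi>)"
    by (rule lipschitz_has_weak_gradient[OF lip B(1) ae])
  have w\<phi>m: "wgrad B \<phi> \<in> borel_measurable ?M"
    by (rule has_weak_gradient_measurable[OF has_weak_gradient_wgrad[OF w\<phi>] B(1)])
  \<comment> \<open>Three gradients of \<phi> meet here: the classical one given by the chain rule,
    \<open>dq_gradient\<close> from the product rule, and \<open>wgrad\<close> from the forms. They
    agree almost everywhere.\<close>
  have w\<phi>_eq: "AE x in ?M. \<exists>e. norm e = 1 \<and> dq_gradient \<phi> x = wgrad B \<phi> x \<and>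
      wgrad B \<phi> x = (- (6 / \<epsilon> * \<phi> x * (1 - \<phi> x))) *\<^sub>R e"
    using wgrad_eq_AE[OF w\<phi> B(1)] grad by eventually_elim (auto dest: dq_gradient_eq)
  have wu: "has_weak_gradient B (\<lambda>x. \<phi> x * u x) (\<lambda>x. \<phi> x *\<^sub>R wgrad B u x + u x *\<^sub>R dq_gradient \<phi> x)"
    if "u \<in> H1_0 B" for u
  proof (rule lipschitz_times_H1_0_has_weak_gradient[OF B lip _ ae that])
    show "\<bar>\<phi> x\<bar> \<le> 1" for x
      using \<phi>01[of x] by simp
  qed
  have meas: "u \<in> borel_measurable ?M" "wgrad B u \<in> borel_measurable ?M"
    "wgrad B (\<lambda>x. \<phi> x * u x) \<in> borel_measurable ?M" if "u \<in> H1_0 B" for u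
  proof -
    have "u \<in> H1 B"
      using that by (simp add: H1_0_def)
    then show "u \<in> borel_measurable ?M" "wgrad B u \<in> borel_measurable ?M"
      using H1_wgrad(2)[OF _ B(1)] by (auto simp: H1_def)
    show "wgrad B (\<lambda>x. \<phi> x * u x) \<in> borel_measurable ?M"
      by (rule has_weak_gradient_measurable[OF has_weak_gradient_wgrad[OF wu[OF that]] B(1)])
  qed
  have all: "AE x in ?M. \<exists>e. norm e = 1 \<and> wgrad B \<phi> x = (- (6 / \<epsilon> * \<phi> x * (1 - \<phi> x))) *\<^sub>R e \<and>
      wgrad B (\<lambda>y. \<phi> y * u y) x = \<phi> x *\<^sub>R wgrad B u x + u x *\<^sub>R wgrad B \<phi> x" if "u \<in> H1_0 B" for u
    using w\<phi>_eq wgrad_eq_AE[OF wu[OF that] B(1)] by eventually_elim auto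
  obtain M where M: "\<And>x. x \<in> B \<Longrightarrow> D x \<le> M"
    using assms(10) unfolding bounded_iff by (force simp: abs_le_iff)
  note coercive = coercive_if_completed_square[OF B(1) assms(7,11,12) M \<phi>m \<phi>01]
  \<comment> \<open>\<open>F0\<close> and \<open>F1\<close> are the integrands of the two forms on
    the diagonal \<open>v = u\<close>.\<close>
  define F0 where "F0 u x = D x * (wgrad B u x \<bullet> wgrad B (\<lambda>y. \<phi> y * u y) x)
      + D x / \<epsilon>\<^sup>2 * (1 - \<phi> x) * u x * u x
      + 3 * D x / (2 * \<epsilon>) * ((1 - \<phi> x) + (1 - \<phi> x)\<^sup>2) * norm (wgrad B \<phi> x) * u x * u x" for u x
  define F1 where "F1 u x = D x * (wgrad B u x \<bullet> wgrad B (\<lambda>y. \<phi> y * u y) x)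
      + D x / \<epsilon>\<^sup>2 * (1 - \<phi> x) * u x * u x
      + D x * u x * (wgrad B \<phi> x \<bullet> wgrad B u x)
      + 3 * D x / (2 * \<epsilon>) * (4 * (1 - \<phi> x) + (1 - \<phi> x)\<^sup>2) * norm (wgrad B \<phi> x) * u x * u x" for u x
  have "coercive_on (H1_0 B) (phase_norm B \<epsilon> \<phi>) (\<lambda>u v. LINT x|?M. F0 u x)"
  proof (rule coercive[where \<kappa>=3])
    fix u assume u: "u \<in> H1_0 B"
    show "F0 u \<in> borel_measurable ?M"
      unfolding F0_def[abs_def] using meas[OF u] \<phi>m w\<phi>m assms(9) by simp
    show "AE x in ?M. \<exists>e. norm e = 1 \<and>
        F0 u x = D x * completed_square 3 \<epsilon> (\<phi> x) (u x) (wgrad B u x) e"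
      using all[OF u]
    proof eventually_elim
      case (elim x)
      then obtain e where e: "norm e = 1" "wgrad B \<phi> x = (- (6 / \<epsilon> * \<phi> x * (1 - \<phi> x))) *\<^sub>R e"
        "wgrad B (\<lambda>y. \<phi> y * u y) x = \<phi> x *\<^sub>R wgrad B u x + u x *\<^sub>R wgrad B \<phi> x"
        by blast
      show ?case
        using a0_integrand_eq[OF assms(7) e(1) \<phi>01 e(2)] e(1) unfolding F0_def e(3) by blast
    qed
  qed
  moreover have "coercive_on (H1_0 B) (phase_norm B \<epsilon> \<phi>) (\<lambda>u v. LINT x|?M. F1 u x)"
  proof (rule coercive[where \<kappa>=6])
    fix u assume u: "u \<in> H1_0 B"
    show "F1 u \<in> borel_measurable ?M"
      unfolding F1_def[abs_def] using meas[OF u] \<phi>m w\<phi>m assms(9) by simp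
    show "AE x in ?M. \<exists>e. norm e = 1 \<and>
        F1 u x = D x * completed_square 6 \<epsilon> (\<phi> x) (u x) (wgrad B u x) e"
      using all[OF u]
    proof eventually_elim
      case (elim x)
      then obtain e where e: "norm e = 1" "wgrad B \<phi> x = (- (6 / \<epsilon> * \<phi> x * (1 - \<phi> x))) *\<^sub>R e"
        "wgrad B (\<lambda>y. \<phi> y * u y) x = \<phi> x *\<^sub>R wgrad B u x + u x *\<^sub>R wgrad B \<phi> x"
        by blast
      show ?case
        using a1_integrand_eq[OF assms(7) e(1) \<phi>01 e(2)] e(1) unfolding F1_def e(3) by blast
    qed
  qed
  \<comment> \<open>\<open>coercive_on\<close> evaluates a form only at equal arguments, where the
    forms coincide with the integrals of \<open>F0\<close> and \<open>F1\<close>.\<close>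
  ultimately show ?thesis
    unfolding coercive_on_def form_a0_def form_a1_def F0_def F1_def by (rule conjI)
qed

end
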